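(* Let $(M,g,\nabla,\nabla^{*})$ be a quasi-statistical manifold, with $\nabla^*$ the $g$-dual connection of $\nabla$ and $T^*$ the torsion of $\nabla^*$, and let $G_{ij}:=R_{(ij)}-\frac12 g_{ij}R$ and $G^*_{ij}:=R^*_{(ij)}-\frac12 g_{ij}R^*$ be the Einstein tensors of $\nabla$ and $\nabla^*$. Then, in any local coordinates, $$\nabla^iG_{ij}=-\tfrac12\Big\{\nabla^i(R^*_{ij}-R_{ji})+(\nabla^ig_{ij})R+(\nabla_hg^{ls})R_{l\ sj}^{\ h}+(\nabla_jg^{ls})R_{ls}+(\nabla_hg^{hs})R^*_{sj}\Big\},$$ $$\begin{aligned}\nabla^{*i}G^*_{ij}=&-\tfrac12\Big\{\nabla^{*i}(R_{ij}-R^*_{ji})+(\nabla^{*i}g_{ij})R^*+(\nabla^*_hg^{ls})R^{*\ h}_{\ l\ sj}+(\nabla^*_jg^{ls})R^*_{ls}+(\nabla^*_hg^{hs})R_{sj}\Big\}\\&+\tfrac12\Big(g^{ls}R^{*\ h}_{\ l\ rj}T^{*r}_{\ \ hs}-g^{ls}R^*_{lr}T^{*r}_{\ \ sj}+g^{ls}R^{*\ h}_{\ l\ rs}T^{*r}_{\ \ jh}\Big),\end{aligned}$$ $$\nabla^{*i}G_{ij}=\nabla^{*i}R_{(ij)}-\tfrac12(\nabla^{*i}g_{ij})R-\tfrac12\nabla^*_jR,$$ $$\nabla^{i}G^*_{ij}=\nabla^{i}R^*_{(ij)}-\tfrac12(\nabla^{i}g_{ij})R^*-\tfrac12\nabl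a_jR^*.$$
   Context: $(M,g)$ is a (pseudo-)Riemannian manifold and $\nabla$ an affine connection on it. The $g$-dual connection $\nabla^*$ is the affine connection determined by $X(g(Y,Z))=g(\nabla_XY,Z)+g(Y,\nabla^*_XZ)$. The torsion is $T(X,Y)=\nabla_XY-\nabla_YX-[X,Y]$, and $T^*$ is the torsion of $\nabla^*$, with components $T^*(\partial_k,\partial_l)=T^{*i}_{\ \ kl}\partial_i$. The triple $(M,g,\nabla)$ is a quasi-statistical manifold if $\nabla$ is torsion-free ($T=0$); $T^*$ need not vanish. The curvature is $R(X,Y)Z=\nabla_X\nabla_YZ-\nabla_Y\nabla_XZ-\nabla_{[X,Y]}Z$, with components $R(\partial_k,\partial_l)\partial_i=R_{i\ kl}^{\ j}\partial_j$; the Ricci tensor is $R_{ij}=R_{i\ kj}^{\ k}$ (sum over $k$), its symmetrization $R_{(ij)}=\frac12(R_{ij}+R_{ji})$, and the Ricci scalar $R=g^{ij}R_{ij}$. Starred quantities $R^{*\ j}_{\ i\ kl}, R^*_{ij},R^*$ are the same objects for $\nabla^*$ (traces also taken with $g$). $g^{ij}$ is the inverse metric, viewed as a $(2,0)$-tensor. $\nabla_k$ denotes covariant derivative along $\partial_k$ of the tensor with the displayed components, $\nabla^i:=g^{is}\nabla_s$, $\nabla^{*i}:=g^{is}\nabla^*_s$ (index raised after differentiation). Summation over repeated indices is understood. *)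

theory Defs
  imports "HOL-Analysis.Analysis"
begin

section \<open>Smooth functions on open subsets of Euclidean space\<close>

definition partial_deriv :: "'n::finite \<Rightarrow> (real^'n \<Rightarrow> real) \<Rightarrow> real^'n \<Rightarrow> real" where
  "partial_deriv i f x = frechet_derivative f (at x) (axis i 1)"

primrec Ck_on :: "nat \<Rightarrow> (real^'n::finite) set \<Rightarrow> (real^'n \<Rightarrow> real) \<Rightarrow> bool" where
  "Ck_on 0 V f \<longleftrightarrow> continuous_on V f"
| "Ck_on (Suc k) V f \<longleftrightarrow> f differentiable_on V \<and> (\<forall>i. Ck_on k V (partial_deriv i f))"

text \<open>Only used for open \<open>V\<close>.\<close>

definition Cinf_on :: "(real^'n::finite) set \<Rightarrow> (real^'n \<Rightarrow> real) \<Rightarrow> bool" where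
  "Cinf_on V f \<longleftrightarrow> (\<forall>k. Ck_on k V f)"


section \<open>Smooth manifolds\<close>

text \<open>The underlying space of the manifold is the whole type \<open>'m\<close> (Hausdorff and second
  countable by its type classes), the dimension is \<open>CARD('n)\<close>. A chart is a pair of a domain and
  a coordinate map; values of the coordinate map off the domain carry no information.\<close>

type_synonym ('m, 'n) chart = "'m set \<times> ('m \<Rightarrow> real^'n)"

definition chart_inv :: "('m, 'n::finite) chart \<Rightarrow> real^'n \<Rightarrow> 'm" where
  "chart_inv c = inv_into (fst c) (snd c)"

definition is_chart :: "('m::topological_space, 'n::finite) chart \<Rightarrow> bool" where
  "is_chart c \<longleftrightarrow> open (fst c) \<and> open (snd c ` fst c) \<and>
     homeomorphism (fst c) (snd c ` fst c) (snd c) (chart_inv c)"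

definition smooth_transition :: "('m, 'n::finite) chart \<Rightarrow> ('m, 'n) chart \<Rightarrow> bool" where
  "smooth_transition c d \<longleftrightarrow>
     (\<forall>i. Cinf_on (snd c ` (fst c \<inter> fst d)) (\<lambda>x. snd d (chart_inv c x) $ i))"

text \<open>A smooth structure is a maximal atlas.\<close>

definition smooth_structure ::
  "('m::{t2_space,second_countable_topology}, 'n::finite) chart set \<Rightarrow> bool" where
  "smooth_structure A \<longleftrightarrow>
     (\<forall>c\<in>A. is_chart c) \<and> (\<Union>c\<in>A. fst c) = UNIV \<and>
     (\<forall>c\<in>A. \<forall>d\<in>A. smooth_transition c d) \<and>
     (\<forall>c. is_chart c \<and> (\<forall>d\<in>A. smooth_transition c d \<and> smooth_transition d c) \<longrightarrow> c \<in> A)"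

definition smooth_fun ::
  "('m::topological_space, 'n::finite) chart set \<Rightarrow> 'm set \<Rightarrow> ('m \<Rightarrow> real) \<Rightarrow> bool" where
  "smooth_fun A W f \<longleftrightarrow>
     open W \<and> (\<forall>c\<in>A. Cinf_on (snd c ` (fst c \<inter> W)) (\<lambda>x. f (chart_inv c x)))"

definition smooth_near ::
  "('m::topological_space, 'n::finite) chart set \<Rightarrow> 'm \<Rightarrow> ('m \<Rightarrow> real) \<Rightarrow> bool" where
  "smooth_near A p f \<longleftrightarrow> (\<exists>W. p \<in> W \<and> smooth_fun A W f)"


section \<open>Tangent vectors and vector fields\<close>

text \<open>A tangent vector acts on the functions that are smooth near its base point as a directional
  derivative in some chart. It is extended by 0 to all other functions, so that equality of
  tangent vectors means equality of their actions on smooth functions.\<close>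

type_synonym 'm tvec = "('m \<Rightarrow> real) \<Rightarrow> real"
type_synonym 'm vfield = "'m \<Rightarrow> 'm tvec"

definition coord_vec ::
  "('m::topological_space, 'n::finite) chart set \<Rightarrow> ('m, 'n) chart \<Rightarrow> 'm \<Rightarrow> real^'n \<Rightarrow> 'm tvec" where
  "coord_vec A c p a = (\<lambda>f. if smooth_near A p f
     then frechet_derivative (\<lambda>x. f (chart_inv c x)) (at (snd c p)) a else 0)"

definition tangent_space ::
  "('m::topological_space, 'n::finite) chart set \<Rightarrow> 'm \<Rightarrow> 'm tvec set" where
  "tangent_space A p = {coord_vec A c p a | c a. c \<in> A \<and> p \<in> fst c}"

text \<open>Vector fields defined on an open set \<open>W\<close> are total functions of which only the values on
  \<open>W\<close> matter.\<close>

definition smooth_vf ::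
  "('m::topological_space, 'n::finite) chart set \<Rightarrow> 'm set \<Rightarrow> 'm vfield \<Rightarrow> bool" where
  "smooth_vf A W X \<longleftrightarrow> open W \<and> (\<forall>p\<in>W. X p \<in> tangent_space A p) \<and>
     (\<forall>V f. V \<subseteq> W \<and> smooth_fun A V f \<longrightarrow> smooth_fun A V (\<lambda>p. X p f))"

definition vf_add :: "'m vfield \<Rightarrow> 'm vfield \<Rightarrow> 'm vfield" where
  "vf_add X Y = (\<lambda>p f. X p f + Y p f)"

definition vf_diff :: "'m vfield \<Rightarrow> 'm vfield \<Rightarrow> 'm vfield" where
  "vf_diff X Y = (\<lambda>p f. X p f - Y p f)"

definition vf_scale :: "('m \<Rightarrow> real) \<Rightarrow> 'm vfield \<Rightarrow> 'm vfield" where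
  "vf_scale h X = (\<lambda>p f. h p * X p f)"

definition lie_bracket ::
  "('m::topological_space, 'n::finite) chart set \<Rightarrow> 'm vfield \<Rightarrow> 'm vfield \<Rightarrow> 'm vfield" where
  "lie_bracket A X Y = (\<lambda>p f. if smooth_near A p f
     then X p (\<lambda>q. Y q f) - Y p (\<lambda>q. X q f) else 0)"


section \<open>Metrics and affine connections\<close>

text \<open>Nondegenerate of arbitrary signature; the Riemannian case is included.\<close>

definition pseudo_riemannian_metric ::
  "('m::topological_space, 'n::finite) chart set \<Rightarrow> ('m \<Rightarrow> 'm tvec \<Rightarrow> 'm tvec \<Rightarrow> real) \<Rightarrow> bool" where
  "pseudo_riemannian_metric A g \<longleftrightarrow>
     (\<forall>p. \<forall>u\<in>tangent_space A p. \<forall>v\<in>tangent_space A p. g p u v = g p v u) \<and>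
     (\<forall>p. \<forall>u\<in>tangent_space A p. \<forall>u'\<in>tangent_space A p. \<forall>v\<in>tangent_space A p.
        g p (\<lambda>f. u f + u' f) v = g p u v + g p u' v) \<and>
     (\<forall>p. \<forall>u\<in>tangent_space A p. \<forall>v\<in>tangent_space A p. \<forall>r.
        g p (\<lambda>f. r * u f) v = r * g p u v) \<and>
     (\<forall>p. \<forall>u\<in>tangent_space A p. (\<forall>v\<in>tangent_space A p. g p u v = 0) \<longrightarrow> u = (\<lambda>f. 0)) \<and>
     (\<forall>W X Y. smooth_vf A W X \<and> smooth_vf A W Y \<longrightarrow> smooth_fun A W (\<lambda>p. g p (X p) (Y p)))"

text \<open>A connection acts on pairs of vector fields defined on a common open set \<open>W\<close>. The first
  clause says that the result on \<open>W\<close> depends only on the fields on \<open>W\<close>, i.e. that the operators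
  for the various open sets are compatible with restriction.\<close>

definition affine_connection ::
  "('m::topological_space, 'n::finite) chart set \<Rightarrow>
   ('m vfield \<Rightarrow> 'm vfield \<Rightarrow> 'm vfield) \<Rightarrow> bool" where
  "affine_connection A D \<longleftrightarrow>
     (\<forall>W X X' Y Y'. smooth_vf A W X \<and> smooth_vf A W X' \<and> smooth_vf A W Y \<and> smooth_vf A W Y' \<and>
        (\<forall>p\<in>W. X p = X' p) \<and> (\<forall>p\<in>W. Y p = Y' p) \<longrightarrow> (\<forall>p\<in>W. D X Y p = D X' Y' p)) \<and>
     (\<forall>W X Y. smooth_vf A W X \<and> smooth_vf A W Y \<longrightarrow> smooth_vf A W (D X Y)) \<and>
     (\<forall>W X X' Y. smooth_vf A W X \<and> smooth_vf A W X' \<and> smooth_vf A W Y \<longrightarrow>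
        (\<forall>p\<in>W. D (vf_add X X') Y p = vf_add (D X Y) (D X' Y) p)) \<and>
     (\<forall>W h X Y. smooth_fun A W h \<and> smooth_vf A W X \<and> smooth_vf A W Y \<longrightarrow>
        (\<forall>p\<in>W. D (vf_scale h X) Y p = vf_scale h (D X Y) p)) \<and>
     (\<forall>W X Y Y'. smooth_vf A W X \<and> smooth_vf A W Y \<and> smooth_vf A W Y' \<longrightarrow>
        (\<forall>p\<in>W. D X (vf_add Y Y') p = vf_add (D X Y) (D X Y') p)) \<and>
     (\<forall>W h X Y. smooth_fun A W h \<and> smooth_vf A W X \<and> smooth_vf A W Y \<longrightarrow>
        (\<forall>p\<in>W. D X (vf_scale h Y) p =
           vf_add (vf_scale (\<lambda>q. X q h) Y) (vf_scale h (D X Y)) p))"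

definition dual_connection ::
  "('m::topological_space, 'n::finite) chart set \<Rightarrow> ('m \<Rightarrow> 'm tvec \<Rightarrow> 'm tvec \<Rightarrow> real) \<Rightarrow>
   ('m vfield \<Rightarrow> 'm vfield \<Rightarrow> 'm vfield) \<Rightarrow> ('m vfield \<Rightarrow> 'm vfield \<Rightarrow> 'm vfield) \<Rightarrow> bool" where
  "dual_connection A g D D' \<longleftrightarrow> affine_connection A D' \<and>
     (\<forall>W X Y Z. smooth_vf A W X \<and> smooth_vf A W Y \<and> smooth_vf A W Z \<longrightarrow>
        (\<forall>p\<in>W. X p (\<lambda>q. g q (Y q) (Z q)) = g p (D X Y p) (Z p) + g p (Y p) (D' X Z p)))"

definition torsion ::
  "('m::topological_space, 'n::finite) chart set \<Rightarrow> ('m vfield \<Rightarrow> 'm vfield \<Rightarrow> 'm vfield) \<Rightarrow>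
   'm vfield \<Rightarrow> 'm vfield \<Rightarrow> 'm vfield" where
  "torsion A D X Y = vf_diff (vf_diff (D X Y) (D Y X)) (lie_bracket A X Y)"

definition curvature ::
  "('m::topological_space, 'n::finite) chart set \<Rightarrow> ('m vfield \<Rightarrow> 'm vfield \<Rightarrow> 'm vfield) \<Rightarrow>
   'm vfield \<Rightarrow> 'm vfield \<Rightarrow> 'm vfield \<Rightarrow> 'm vfield" where
  "curvature A D X Y Z =
     vf_diff (vf_diff (D X (D Y Z)) (D Y (D X Z))) (D (lie_bracket A X Y) Z)"

definition torsion_free ::
  "('m::topological_space, 'n::finite) chart set \<Rightarrow>
   ('m vfield \<Rightarrow> 'm vfield \<Rightarrow> 'm vfield) \<Rightarrow> bool" where
  "torsion_free A D \<longleftrightarrow>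
     (\<forall>W X Y. smooth_vf A W X \<and> smooth_vf A W Y \<longrightarrow> (\<forall>p\<in>W. torsion A D X Y p = (\<lambda>f. 0)))"

definition quasi_statistical_manifold ::
  "('m::{t2_space,second_countable_topology}, 'n::finite) chart set \<Rightarrow>
   ('m \<Rightarrow> 'm tvec \<Rightarrow> 'm tvec \<Rightarrow> real) \<Rightarrow> ('m vfield \<Rightarrow> 'm vfield \<Rightarrow> 'm vfield) \<Rightarrow> bool" where
  "quasi_statistical_manifold A g D \<longleftrightarrow> smooth_structure A \<and> pseudo_riemannian_metric A g \<and>
     affine_connection A D \<and> torsion_free A D"


section \<open>Components in local coordinates\<close>

text \<open>The coordinate field of \<open>x\<^sup>k\<close>. Since tangent vectors act on functions,
  \<open>coord_field A c k p f\<close> is also the partial derivative of \<open>f\<close> along \<open>x\<^sup>k\<close>.\<close>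

definition coord_field ::
  "('m::topological_space, 'n::finite) chart set \<Rightarrow> ('m, 'n) chart \<Rightarrow> 'n \<Rightarrow> 'm vfield" where
  "coord_field A c k p = coord_vec A c p (axis k 1)"

text \<open>The \<open>i\<close>-th component of a tangent vector is its value on the coordinate function \<open>x\<^sup>i\<close>.\<close>

definition vec_comp :: "('m, 'n::finite) chart \<Rightarrow> 'm tvec \<Rightarrow> 'n \<Rightarrow> real" where
  "vec_comp c v i = v (\<lambda>q. snd c q $ i)"

definition metric_comp ::
  "('m::topological_space, 'n::finite) chart set \<Rightarrow> ('m, 'n) chart \<Rightarrow>
   ('m \<Rightarrow> 'm tvec \<Rightarrow> 'm tvec \<Rightarrow> real) \<Rightarrow> 'n \<Rightarrow> 'n \<Rightarrow> 'm \<Rightarrow> real" where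
  "metric_comp A c g i j p = g p (coord_field A c i p) (coord_field A c j p)"

definition metric_inv_comp ::
  "('m::topological_space, 'n::finite) chart set \<Rightarrow> ('m, 'n) chart \<Rightarrow>
   ('m \<Rightarrow> 'm tvec \<Rightarrow> 'm tvec \<Rightarrow> real) \<Rightarrow> 'n \<Rightarrow> 'n \<Rightarrow> 'm \<Rightarrow> real" where
  "metric_inv_comp A c g i j p = matrix_inv (\<chi> k l. metric_comp A c g k l p) $ i $ j"

text \<open>\<open>christoffel A c D m k l\<close> is the \<open>m\<close>-th component of the derivative of the \<open>l\<close>-th
  coordinate field along the \<open>k\<close>-th one; the order of \<open>k\<close> and \<open>l\<close> matters in the presence of
  torsion.\<close>

definition christoffel ::
  "('m::topological_space, 'n::finite) chart set \<Rightarrow> ('m, 'n) chart \<Rightarrow>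
   ('m vfield \<Rightarrow> 'm vfield \<Rightarrow> 'm vfield) \<Rightarrow> 'n \<Rightarrow> 'n \<Rightarrow> 'n \<Rightarrow> 'm \<Rightarrow> real" where
  "christoffel A c D m k l p = vec_comp c (D (coord_field A c k) (coord_field A c l) p) m"

text \<open>\<open>torsion_comp A c D i k l\<close> is $T^i_{\ kl}$.\<close>

definition torsion_comp ::
  "('m::topological_space, 'n::finite) chart set \<Rightarrow> ('m, 'n) chart \<Rightarrow>
   ('m vfield \<Rightarrow> 'm vfield \<Rightarrow> 'm vfield) \<Rightarrow> 'n \<Rightarrow> 'n \<Rightarrow> 'n \<Rightarrow> 'm \<Rightarrow> real" where
  "torsion_comp A c D i k l p =
     vec_comp c (torsion A D (coord_field A c k) (coord_field A c l) p) i"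

text \<open>\<open>curv_comp A c D i j k l\<close> is $R_{i\ kl}^{\ j}$, i.e. the \<open>j\<close>-th component of
  $R(\partial_k,\partial_l)\partial_i$.\<close>

definition curv_comp ::
  "('m::topological_space, 'n::finite) chart set \<Rightarrow> ('m, 'n) chart \<Rightarrow>
   ('m vfield \<Rightarrow> 'm vfield \<Rightarrow> 'm vfield) \<Rightarrow> 'n \<Rightarrow> 'n \<Rightarrow> 'n \<Rightarrow> 'n \<Rightarrow> 'm \<Rightarrow> real" where
  "curv_comp A c D i j k l p =
     vec_comp c (curvature A D (coord_field A c k) (coord_field A c l) (coord_field A c i) p) j"

definition ricci ::
  "('m::topological_space, 'n::finite) chart set \<Rightarrow> ('m, 'n) chart \<Rightarrow>
   ('m vfield \<Rightarrow> 'm vfield \<Rightarrow> 'm vfield) \<Rightarrow> 'n \<Rightarrow> 'n \<Rightarrow> 'm \<Rightarrow> real" where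
  "ricci A c D i j p = (\<Sum>k\<in>UNIV. curv_comp A c D i k k j p)"

definition ricci_sym ::
  "('m::topological_space, 'n::finite) chart set \<Rightarrow> ('m, 'n) chart \<Rightarrow>
   ('m vfield \<Rightarrow> 'm vfield \<Rightarrow> 'm vfield) \<Rightarrow> 'n \<Rightarrow> 'n \<Rightarrow> 'm \<Rightarrow> real" where
  "ricci_sym A c D i j p = 1/2 * (ricci A c D i j p + ricci A c D j i p)"

definition ricci_scalar ::
  "('m::topological_space, 'n::finite) chart set \<Rightarrow> ('m, 'n) chart \<Rightarrow>
   ('m \<Rightarrow> 'm tvec \<Rightarrow> 'm tvec \<Rightarrow> real) \<Rightarrow> ('m vfield \<Rightarrow> 'm vfield \<Rightarrow> 'm vfield) \<Rightarrow> 'm \<Rightarrow> real" where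
  "ricci_scalar A c g D p =
     (\<Sum>i\<in>UNIV. \<Sum>j\<in>UNIV. metric_inv_comp A c g i j p * ricci A c D i j p)"

definition einstein ::
  "('m::topological_space, 'n::finite) chart set \<Rightarrow> ('m, 'n) chart \<Rightarrow>
   ('m \<Rightarrow> 'm tvec \<Rightarrow> 'm tvec \<Rightarrow> real) \<Rightarrow> ('m vfield \<Rightarrow> 'm vfield \<Rightarrow> 'm vfield) \<Rightarrow>
   'n \<Rightarrow> 'n \<Rightarrow> 'm \<Rightarrow> real" where
  "einstein A c g D i j p =
     ricci_sym A c D i j p - 1/2 * metric_comp A c g i j p * ricci_scalar A c g D p"


section \<open>Covariant derivatives of tensors in local coordinates\<close>

text \<open>\<open>cov_scalar A c k R\<close> is $\nabla_k R$ for a function \<open>R\<close>, which is the same for every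
  connection; \<open>cov_lower A c D S k i j\<close> is $\nabla_k S_{ij}$; \<open>cov_upper A c D S k i j\<close> is
  $\nabla_k S^{ij}$; \<open>div_lower A c g D S j\<close> is $\nabla^i S_{ij} = g^{is}\nabla_s S_{ij}$.\<close>

definition cov_scalar ::
  "('m::topological_space, 'n::finite) chart set \<Rightarrow> ('m, 'n) chart \<Rightarrow> 'n \<Rightarrow>
   ('m \<Rightarrow> real) \<Rightarrow> 'm \<Rightarrow> real" where
  "cov_scalar A c k h p = coord_field A c k p h"

definition cov_lower ::
  "('m::topological_space, 'n::finite) chart set \<Rightarrow> ('m, 'n) chart \<Rightarrow>
   ('m vfield \<Rightarrow> 'm vfield \<Rightarrow> 'm vfield) \<Rightarrow> ('n \<Rightarrow> 'n \<Rightarrow> 'm \<Rightarrow> real) \<Rightarrow>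
   'n \<Rightarrow> 'n \<Rightarrow> 'n \<Rightarrow> 'm \<Rightarrow> real" where
  "cov_lower A c D S k i j p = coord_field A c k p (S i j)
     - (\<Sum>m\<in>UNIV. christoffel A c D m k i p * S m j p)
     - (\<Sum>m\<in>UNIV. christoffel A c D m k j p * S i m p)"

definition cov_upper ::
  "('m::topological_space, 'n::finite) chart set \<Rightarrow> ('m, 'n) chart \<Rightarrow>
   ('m vfield \<Rightarrow> 'm vfield \<Rightarrow> 'm vfield) \<Rightarrow> ('n \<Rightarrow> 'n \<Rightarrow> 'm \<Rightarrow> real) \<Rightarrow>
   'n \<Rightarrow> 'n \<Rightarrow> 'n \<Rightarrow> 'm \<Rightarrow> real" where
  "cov_upper A c D S k i j p = coord_field A c k p (S i j)
     + (\<Sum>m\<in>UNIV. christoffel A c D i k m p * S m j p)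
     + (\<Sum>m\<in>UNIV. christoffel A c D j k m p * S i m p)"

definition div_lower ::
  "('m::topological_space, 'n::finite) chart set \<Rightarrow> ('m, 'n) chart \<Rightarrow>
   ('m \<Rightarrow> 'm tvec \<Rightarrow> 'm tvec \<Rightarrow> real) \<Rightarrow> ('m vfield \<Rightarrow> 'm vfield \<Rightarrow> 'm vfield) \<Rightarrow>
   ('n \<Rightarrow> 'n \<Rightarrow> 'm \<Rightarrow> real) \<Rightarrow> 'n \<Rightarrow> 'm \<Rightarrow> real" where
  "div_lower A c g D S j p =
     (\<Sum>i\<in>UNIV. \<Sum>s\<in>UNIV. metric_inv_comp A c g i s p * cov_lower A c D S s i j p)"

end

theory Submission
  imports Defs
begin

text \<open>Everything is local, so one chart is fixed. There the coordinate fields span all fields and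
  commute, because mixed partial derivatives of smooth functions are symmetric.

  The product rule alone gives, for the Einstein tensor \<open>G\<close> of a connection with Ricci scalar \<open>R\<close>,
  $$\nabla^i G_{ij} = \nabla^i R_{(ij)} - \tfrac12 (\nabla^i g_{ij}) R - \tfrac12 \partial_j R,$$
  and it does so whichever connection the divergence is taken with (\<open>div_einstein\<close>). These are
  the two identities in which curvature and divergence belong to different connections. For the
  other two it remains to express $\partial_j R$ by divergences, which is
  \<open>cov_scalar_ricci_scalar\<close>. Two facts about curvature are used.

  One is the second Bianchi identity for a connection with torsion (\<open>second_bianchi\<close>), obtained
  from the Jacobi identity for the operators $\nabla_k$ along the coordinate fields. Traced once
  (\<open>contracted_bianchi\<close>), it replaces $\nabla_j R_{ls}$ by $\nabla_s R_{lj}$, the divergence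
  $\nabla_h R_{l\ sj}^{\ h}$ and torsion terms.

  The other is that dual connections have opposite curvatures,
  $g(R(X,Y)Z,W) = - g(Z,R^*(X,Y)W)$ (\<open>curvature_dual\<close>), as one sees by differentiating $g(Z,W)$
  twice. It yields $g^{ls} R_{l\ sj}^{\ h} = - g^{hm} R^*_{mj}$. Taking the divergence of both sides
  turns the traced divergence of the curvature into the divergence of the dual Ricci tensor and
  covariant derivatives of the inverse metric (\<open>divergence_contracted_curv\<close>).

  Duality is a symmetric relation, so the resulting formula \<open>div_einstein_dual_pair\<close> holds for
  $(\nabla,\nabla^*)$ and for $(\nabla^*,\nabla)$. In the first case the torsion terms vanish.\<close>

section \<open>Smooth functions on open sets of Euclidean space\<close>

lemma partial_deriv_eqI:
  assumes "(f has_derivative f') (at x)"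
  shows "partial_deriv i f x = f' (axis i 1)"
  using frechet_derivative_at[OF assms] by (simp add: partial_deriv_def)

lemma has_derivative_transform_open_iff:
  assumes "open V" "x \<in> V" "\<And>y. y \<in> V \<Longrightarrow> f y = g y"
  shows "(f has_derivative f') (at x) \<longleftrightarrow> (g has_derivative f') (at x)"
  using assms has_derivative_transform_within_open by (metis (no_types, lifting))

lemma frechet_derivative_cong_open:
  assumes "open V" "x \<in> V" "\<And>y. y \<in> V \<Longrightarrow> f y = g y"
  shows "frechet_derivative f (at x) = frechet_derivative g (at x)"
  unfolding frechet_derivative_def
  using has_derivative_transform_open_iff[OF assms] by presburger

lemma partial_deriv_cong_open:
  assumes "open V" "x \<in> V" "\<And>y. y \<in> V \<Longrightarrow> f y = g y"
  shows "partial_deriv i f x = partial_deriv i g x"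
  using frechet_derivative_cong_open[OF assms] by (simp add: partial_deriv_def)

lemma has_derivative_frechet:
  "f differentiable (at x) \<Longrightarrow> (f has_derivative frechet_derivative f (at x)) (at x)"
  by (simp add: frechet_derivative_works)

lemma frechet_derivative_partial:
  fixes f :: "real^'n::finite \<Rightarrow> real"
  assumes "f differentiable (at x)"
  shows "frechet_derivative f (at x) a = (\<Sum>i\<in>UNIV. a $ i * partial_deriv i f x)"
proof -
  have lin: "linear (frechet_derivative f (at x))"
    by (rule linear_frechet_derivative[OF assms])
  have "frechet_derivative f (at x) a
      = frechet_derivative f (at x) (\<Sum>i\<in>UNIV. a $ i *\<^sub>R axis i 1)"
    using basis_expansion[of a] by (simp add: scalar_mult_eq_scaleR)
  also have "\<dots> = (\<Sum>i\<in>UNIV. a $ i * partial_deriv i f x)"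
    by (simp add: linear_sum[OF lin] linear_cmul[OF lin] partial_deriv_def)
  finally show ?thesis .
qed

lemma partial_deriv_const: "partial_deriv i (\<lambda>x. a) x = 0"
  by (simp add: partial_deriv_def)

lemma partial_deriv_component:
  fixes x :: "real^'n::finite"
  shows "partial_deriv i (\<lambda>x. x $ m) x = (if m = i then 1 else 0)"
  by (subst partial_deriv_eqI[OF bounded_linear_imp_has_derivative[OF bounded_linear_vec_nth]])
    (simp add: axis_def)

lemma partial_deriv_add:
  assumes "f differentiable (at x)" "h differentiable (at x)"
  shows "partial_deriv i (\<lambda>x. f x + h x) x = partial_deriv i f x + partial_deriv i h x"
  by (subst partial_deriv_eqI[OF has_derivative_add[OF assms[THEN has_derivative_frechet]]])
    (simp add: partial_deriv_def)

lemma partial_deriv_mult: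
  fixes f h :: "real^'n::finite \<Rightarrow> real"
  assumes "f differentiable (at x)" "h differentiable (at x)"
  shows "partial_deriv i (\<lambda>x. f x * h x) x = f x * partial_deriv i h x + partial_deriv i f x * h x"
  by (subst partial_deriv_eqI[OF has_derivative_mult[OF assms[THEN has_derivative_frechet]]])
    (simp add: partial_deriv_def)

lemma partial_deriv_inverse:
  fixes f :: "real^'n::finite \<Rightarrow> real"
  assumes "f differentiable (at x)" "f x \<noteq> 0"
  shows "partial_deriv i (\<lambda>x. inverse (f x)) x
    = (- 1) * (partial_deriv i f x * (inverse (f x) * inverse (f x)))"
  by (subst partial_deriv_eqI[OF Deriv.has_derivative_inverse[OF assms(2) has_derivative_frechet[OF assms(1)]]])
    (simp add: partial_deriv_def)

lemma frechet_derivative_chain: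
  fixes f :: "real^'n::finite \<Rightarrow> real" and \<phi> :: "real^'m::finite \<Rightarrow> real^'n"
  assumes "f differentiable (at (\<phi> x))" "\<And>m. (\<lambda>x. \<phi> x $ m) differentiable (at x)"
  shows "(\<lambda>x. f (\<phi> x)) differentiable (at x)"
    and "frechet_derivative (\<lambda>x. f (\<phi> x)) (at x) a
      = (\<Sum>m\<in>UNIV. frechet_derivative (\<lambda>x. \<phi> x $ m) (at x) a * partial_deriv m f (\<phi> x))"
proof -
  let ?d = "\<lambda>a. \<chi> m. frechet_derivative (\<lambda>x. \<phi> x $ m) (at x) a"
  have "(\<phi> has_derivative ?d) (at x)"
    unfolding has_derivative_componentwise_within[of \<phi>]
  proof
    fix b :: "real^'n" assume "b \<in> Basis"
    then obtain m where b: "b = axis m 1"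
      by (auto simp: Basis_vec_def)
    show "((\<lambda>x. \<phi> x \<bullet> b) has_derivative (\<lambda>a. ?d a \<bullet> b)) (at x)"
      using has_derivative_frechet[OF assms(2)[of m]] by (simp add: b inner_axis)
  qed
  from has_derivative_compose[OF this has_derivative_frechet[OF assms(1)]]
  have *: "((\<lambda>x. f (\<phi> x)) has_derivative (\<lambda>a. frechet_derivative f (at (\<phi> x)) (?d a))) (at x)" .
  show "(\<lambda>x. f (\<phi> x)) differentiable (at x)"
    using * by (auto simp: differentiable_def)
  show "frechet_derivative (\<lambda>x. f (\<phi> x)) (at x) a
      = (\<Sum>m\<in>UNIV. frechet_derivative (\<lambda>x. \<phi> x $ m) (at x) a * partial_deriv m f (\<phi> x))"
    using frechet_derivative_at[OF *, symmetric]
    by (simp add: frechet_derivative_partial[OF assms(1)])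
qed

lemma partial_deriv_chain:
  fixes f :: "real^'n::finite \<Rightarrow> real" and \<phi> :: "real^'m::finite \<Rightarrow> real^'n"
  assumes "f differentiable (at (\<phi> x))" "\<And>m. (\<lambda>x. \<phi> x $ m) differentiable (at x)"
  shows "partial_deriv i (\<lambda>x. f (\<phi> x)) x
      = (\<Sum>m\<in>UNIV. partial_deriv i (\<lambda>x. \<phi> x $ m) x * partial_deriv m f (\<phi> x))"
  unfolding partial_deriv_def[of i] by (rule frechet_derivative_chain[OF assms])

lemma Ck_on_cong_open:
  assumes "open V" "\<And>x. x \<in> V \<Longrightarrow> f x = h x" "Ck_on k V f"
  shows "Ck_on k V h"
  using assms(2,3)
proof (induction k arbitrary: f h)
  case 0
  then show ?case by (simp add: continuous_on_cong[of V V f h])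
next
  case (Suc k)
  have "h differentiable (at x)" if x: "x \<in> V" for x
  proof -
    have "f differentiable (at x)"
      using Suc.prems(2) x by (simp add: differentiable_on_eq_differentiable_at[OF \<open>open V\<close>])
    then show ?thesis
      unfolding differentiable_def
      using has_derivative_transform_open_iff[OF \<open>open V\<close> x, of f h] Suc.prems(1) by blast
  qed
  then have "h differentiable_on V"
    by (simp add: differentiable_on_eq_differentiable_at[OF \<open>open V\<close>])
  moreover have "Ck_on k V (partial_deriv i h)" for i
  proof (rule Suc.IH)
    show "partial_deriv i f x = partial_deriv i h x" if "x \<in> V" for x
      using that Suc.prems(1) by (rule partial_deriv_cong_open[OF \<open>open V\<close>])
    show "Ck_on k V (partial_deriv i f)" using Suc.prems(2) by simp
  qed
  ultimately show ?case by simp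
qed

lemma Ck_on_subset: "Ck_on k W f \<Longrightarrow> V \<subseteq> W \<Longrightarrow> Ck_on k V f"
  by (induction k arbitrary: f) (auto intro: continuous_on_subset differentiable_on_subset)

lemma Ck_on_Suc_imp: "Ck_on (Suc k) V f \<Longrightarrow> Ck_on k V f"
proof (induction k arbitrary: f)
  case 0
  then show ?case by (simp add: differentiable_imp_continuous_on)
next
  case (Suc k)
  then show ?case by (metis Ck_on.simps(2))
qed

lemma Ck_on_Suc_differentiable:
  "Ck_on (Suc k) V f \<Longrightarrow> open V \<Longrightarrow> x \<in> V \<Longrightarrow> f differentiable (at x)"
  by (simp add: differentiable_on_eq_differentiable_at)

lemma Ck_on_SucI:
  assumes "open V" "\<And>x. x \<in> V \<Longrightarrow> f differentiable (at x)"
    and "\<And>i x. x \<in> V \<Longrightarrow> h i x = partial_deriv i f x" "\<And>i. Ck_on k V (h i)"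
  shows "Ck_on (Suc k) V f"
  using assms Ck_on_cong_open[OF \<open>open V\<close> assms(3) assms(4)]
  by (simp add: differentiable_on_eq_differentiable_at)

lemma Ck_on_const: "Ck_on k (V :: (real^'a::finite) set) (\<lambda>x. a)"
proof (induction k arbitrary: a)
  case (Suc k)
  have "partial_deriv i (\<lambda>x::real^'a. a) = (\<lambda>x. 0)" for i
    by (simp add: partial_deriv_const fun_eq_iff)
  then show ?case using Suc by simp
qed simp

lemma Ck_on_add:
  assumes "open V"
  shows "Ck_on k V f \<Longrightarrow> Ck_on k V h \<Longrightarrow> Ck_on k V (\<lambda>x. f x + h x)"
proof (induction k arbitrary: f h)
  case 0
  then show ?case by (simp add: continuous_on_add)
next
  case (Suc k)
  show ?case
  proof (rule Ck_on_SucI[OF assms])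
    fix x assume "x \<in> V"
    then have d: "f differentiable (at x)" "h differentiable (at x)"
      using Suc.prems assms Ck_on_Suc_differentiable by blast+
    then show "(\<lambda>x. f x + h x) differentiable (at x)" by simp
    show "partial_deriv i f x + partial_deriv i h x = partial_deriv i (\<lambda>x. f x + h x) x" for i
      by (simp add: partial_deriv_add[OF d])
  qed (use Suc in auto)
qed

lemma Ck_on_mult:
  assumes "open V"
  shows "Ck_on k V f \<Longrightarrow> Ck_on k V h \<Longrightarrow> Ck_on k V (\<lambda>x. f x * h x)"
proof (induction k arbitrary: f h)
  case 0
  then show ?case by (simp add: continuous_on_mult)
next
  case (Suc k)
  show ?case
  proof (rule Ck_on_SucI[OF assms])
    fix x assume "x \<in> V"
    then have d: "f differentiable (at x)" "h differentiable (at x)"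
      using Suc.prems assms Ck_on_Suc_differentiable by blast+
    then show "(\<lambda>x. f x * h x) differentiable (at x)" by simp
    show "f x * partial_deriv i h x + partial_deriv i f x * h x
        = partial_deriv i (\<lambda>x. f x * h x) x" for i
      by (simp add: partial_deriv_mult[OF d])
  next
    fix i
    show "Ck_on k V (\<lambda>x. f x * partial_deriv i h x + partial_deriv i f x * h x)"
      using Suc.prems by (intro Ck_on_add[OF assms] Suc.IH) (auto dest: Ck_on_Suc_imp simp del: Ck_on.simps, auto)
  qed
qed

lemma Ck_on_sum:
  assumes "open V" "\<And>a. a \<in> F \<Longrightarrow> Ck_on k V (f a)"
  shows "Ck_on k V (\<lambda>x. \<Sum>a\<in>F. f a x)"
  using assms(2) by (induction F rule: infinite_finite_induct)
    (auto intro: Ck_on_const Ck_on_add[OF assms(1)])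

lemma Ck_on_inverse:
  assumes "open V" "\<And>x. x \<in> V \<Longrightarrow> f x \<noteq> 0"
  shows "Ck_on k V f \<Longrightarrow> Ck_on k V (\<lambda>x. inverse (f x))"
proof (induction k)
  case 0
  then show ?case using assms by (simp add: continuous_on_inverse)
next
  case (Suc k)
  show ?case
  proof (rule Ck_on_SucI[OF assms(1)])
    fix x assume x: "x \<in> V"
    then have d: "f differentiable (at x)"
      using Suc.prems assms Ck_on_Suc_differentiable by blast
    then show "(\<lambda>x. inverse (f x)) differentiable (at x)" using assms(2) x by simp
    show "(- 1) * (partial_deriv i f x * (inverse (f x) * inverse (f x)))
        = partial_deriv i (\<lambda>x. inverse (f x)) x" for i
      using partial_deriv_inverse[OF d assms(2)[OF x]] by simp
  next
    fix i
    have "Ck_on k V (\<lambda>x. inverse (f x))" "Ck_on k V (partial_deriv i f)"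
      using Suc.IH Ck_on_Suc_imp[OF Suc.prems] Suc.prems by auto
    then show "Ck_on k V (\<lambda>x. (- 1) * (partial_deriv i f x * (inverse (f x) * inverse (f x))))"
      by (intro Ck_on_mult[OF assms(1)] Ck_on_const)
  qed
qed

lemma Ck_on_compose:
  fixes f :: "real^'n::finite \<Rightarrow> real" and \<phi> :: "real^'m::finite \<Rightarrow> real^'n"
  assumes "open V" "open W" "\<phi> ` V \<subseteq> W"
  shows "Ck_on k W f \<Longrightarrow> (\<And>m. Ck_on k V (\<lambda>x. \<phi> x $ m)) \<Longrightarrow> Ck_on k V (\<lambda>x. f (\<phi> x))"
proof (induction k arbitrary: f)
  case 0
  have "continuous_on V (\<lambda>x. \<phi> x $ m)" for m
    using 0(2)[of m] by simp
  then have "continuous_on V \<phi>"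
    using continuous_on_vec_lambda[of V "\<lambda>m x. \<phi> x $ m"] by simp
  then show ?case
    using 0(1) assms(3) continuous_on_compose2[of W f V \<phi>] by simp
next
  case (Suc k)
  show ?case
  proof (rule Ck_on_SucI[OF assms(1)])
    fix x assume x: "x \<in> V"
    have d: "f differentiable (at (\<phi> x))" "\<And>m. (\<lambda>x. \<phi> x $ m) differentiable (at x)"
      using Suc.prems assms x Ck_on_Suc_differentiable by blast+
    show "(\<lambda>x. f (\<phi> x)) differentiable (at x)"
      by (rule frechet_derivative_chain(1)[OF d])
    show "(\<Sum>m\<in>UNIV. partial_deriv i (\<lambda>x. \<phi> x $ m) x * partial_deriv m f (\<phi> x))
        = partial_deriv i (\<lambda>x. f (\<phi> x)) x" for i
      using partial_deriv_chain[OF d] by simp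
  next
    fix i
    have "Ck_on k V (partial_deriv i (\<lambda>x. \<phi> x $ m))" for m
      using Suc.prems(2)[of m] by simp
    moreover have "Ck_on k V (\<lambda>x. partial_deriv m f (\<phi> x))" for m
    proof (rule Suc.IH)
      show "Ck_on k W (partial_deriv m f)" using Suc.prems(1) by simp
      show "Ck_on k V (\<lambda>x. \<phi> x $ m)" for m by (rule Ck_on_Suc_imp[OF Suc.prems(2)])
    qed
    ultimately show "Ck_on k V (\<lambda>x. \<Sum>m\<in>UNIV. partial_deriv i (\<lambda>x. \<phi> x $ m) x * partial_deriv m f (\<phi> x))"
      by (intro Ck_on_sum[OF assms(1)] Ck_on_mult[OF assms(1)])
  qed
qed

lemma Cinf_on_differentiable: "Cinf_on V f \<Longrightarrow> open V \<Longrightarrow> x \<in> V \<Longrightarrow> f differentiable (at x)"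
  using Ck_on_Suc_differentiable unfolding Cinf_on_def by blast

lemma Cinf_on_partial_deriv: "Cinf_on V f \<Longrightarrow> Cinf_on V (partial_deriv i f)"
  unfolding Cinf_on_def using Ck_on.simps(2) by blast

lemma has_real_derivative_along_axis:
  fixes F :: "real^'n::finite \<Rightarrow> real"
  assumes "F differentiable (at (x + s *\<^sub>R axis i 1))"
  shows "((\<lambda>s. F (x + s *\<^sub>R axis i 1)) has_real_derivative partial_deriv i F (x + s *\<^sub>R axis i 1)) (at s)"
proof -
  have "((\<lambda>s. x + s *\<^sub>R axis i (1::real)) has_derivative (\<lambda>u. u *\<^sub>R axis i 1)) (at s)"
    by (auto intro!: derivative_eq_intros)
  from has_derivative_compose[OF this has_derivative_frechet[OF assms]] show ?thesis
    unfolding has_field_derivative_def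
    by (rule has_derivative_eq_rhs)
      (simp add: fun_eq_iff partial_deriv_def linear_cmul[OF linear_frechet_derivative[OF assms]])
qed

text \<open>The second difference of \<open>f\<close> over a small square is, by the mean value theorem applied
  once in each direction, the side squared times a mixed second derivative at some nearby point.
  The order of the two directions decides which mixed derivative appears, but the second
  difference itself is symmetric in them.\<close>

lemma second_difference_eq_mixed_partial:
  fixes f :: "real^'n::finite \<Rightarrow> real"
  assumes f: "\<And>y. y \<in> ball x r \<Longrightarrow> f differentiable (at y)"
    and f': "\<And>y. y \<in> ball x r \<Longrightarrow> partial_deriv i f differentiable (at y)"
    and h: "0 < h" "2 * h < r"
  obtains y where "dist x y \<le> 2 * h"
    and "f (x + h *\<^sub>R axis i 1 + h *\<^sub>R axis j 1) - f (x + h *\<^sub>R axis i 1) - f (x + h *\<^sub>R axis j 1) + f x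
       = h * h * partial_deriv j (partial_deriv i f) y"
proof -
  define P where "P s t = x + s *\<^sub>R axis i 1 + t *\<^sub>R axis j (1::real)" for s t :: real
  have near: "dist x (P s t) \<le> 2 * h" if "0 \<le> s" "s \<le> h" "0 \<le> t" "t \<le> h" for s t
  proof -
    have "dist x (P s t) = norm (s *\<^sub>R axis i (1::real) + t *\<^sub>R axis j (1::real))"
      unfolding P_def dist_norm by (metis add.assoc add_diff_cancel_left' norm_minus_commute)
    also have "\<dots> \<le> norm (s *\<^sub>R axis i (1::real) :: real^'n) + norm (t *\<^sub>R axis j (1::real) :: real^'n)"
      by (rule norm_triangle_ineq)
    also have "\<dots> \<le> 2 * h" using that by simp
    finally show ?thesis .
  qed
  then have inb: "P s t \<in> ball x r" if "0 \<le> s" "s \<le> h" "0 \<le> t" "t \<le> h" for s t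
    using that h by fastforce
  have line_i: "((\<lambda>s. F (P s t)) has_real_derivative partial_deriv i F (P s t)) (at s)"
    if "F differentiable (at (P s t))" for F s t
    using has_real_derivative_along_axis[of F "x + t *\<^sub>R axis j 1" s i] that
    by (simp add: P_def add.assoc add.commute[of "t *\<^sub>R axis j 1"])
  have line_j: "((\<lambda>t. F (P s t)) has_real_derivative partial_deriv j F (P s t)) (at t)"
    if "F differentiable (at (P s t))" for F s t
    using has_real_derivative_along_axis[of F "x + s *\<^sub>R axis i 1" t j] that
    by (simp add: P_def)
  have "\<exists>s. 0 < s \<and> s < h \<and> (f (P h h) - f (P h 0)) - (f (P 0 h) - f (P 0 0))
      = (h - 0) * (partial_deriv i f (P s h) - partial_deriv i f (P s 0))"
    using h by (intro MVT2 DERIV_diff line_i f inb) auto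
  then obtain s where s: "0 < s" "s < h" and es: "(f (P h h) - f (P h 0)) - (f (P 0 h) - f (P 0 0))
      = h * (partial_deriv i f (P s h) - partial_deriv i f (P s 0))" by auto
  have "\<exists>t. 0 < t \<and> t < h \<and> partial_deriv i f (P s h) - partial_deriv i f (P s 0)
      = (h - 0) * partial_deriv j (partial_deriv i f) (P s t)"
    using h s by (intro MVT2 line_j f' inb) auto
  then obtain t where t: "0 < t" "t < h" and et: "partial_deriv i f (P s h) - partial_deriv i f (P s 0)
      = h * partial_deriv j (partial_deriv i f) (P s t)" by auto
  show ?thesis
  proof (rule that)
    show "dist x (P s t) \<le> 2 * h" using near s t by simp
    show "f (x + h *\<^sub>R axis i 1 + h *\<^sub>R axis j 1) - f (x + h *\<^sub>R axis i 1) - f (x + h *\<^sub>R axis j 1) + f x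
       = h * h * partial_deriv j (partial_deriv i f) (P s t)"
      using es et by (simp add: P_def algebra_simps)
  qed
qed

lemma partial_deriv_commute:
  fixes f :: "real^'n::finite \<Rightarrow> real"
  assumes f: "Cinf_on V f" and V: "open V" "x \<in> V"
  shows "partial_deriv i (partial_deriv j f) x = partial_deriv j (partial_deriv i f) x"
proof (rule ccontr)
  let ?a = "partial_deriv i (partial_deriv j f)" and ?b = "partial_deriv j (partial_deriv i f)"
  assume ne: "?a x \<noteq> ?b x"
  define e where "e = \<bar>?a x - ?b x\<bar> / 2"
  have e: "e > 0" using ne by (simp add: e_def)
  have cont: "isCont ?a x" "isCont ?b x"
    using f V by (auto intro!: differentiable_imp_continuous_within Cinf_on_differentiable[of V] Cinf_on_partial_deriv)
  obtain da where da: "da > 0" "\<And>y. dist y x < da \<Longrightarrow> dist (?a y) (?a x) < e"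
    using cont(1) e by (metis (full_types) LIM_def continuous_at dist_self)
  obtain db where db: "db > 0" "\<And>y. dist y x < db \<Longrightarrow> dist (?b y) (?b x) < e"
    using cont(2) e by (metis (full_types) LIM_def continuous_at dist_self)
  obtain r where r: "r > 0" "ball x r \<subseteq> V" using V openE by blast
  define h where "h = min r (min da db) / 4"
  have h: "0 < h" "2 * h < r" "2 * h < da" "2 * h < db"
    using r da db by (auto simp: h_def)
  have df: "f differentiable (at y)" "partial_deriv k f differentiable (at y)" if "y \<in> ball x r" for y k
    using that r f V Cinf_on_differentiable Cinf_on_partial_deriv by blast+
  obtain y where y: "dist x y \<le> 2 * h" "f (x + h *\<^sub>R axis i 1 + h *\<^sub>R axis j 1)
      - f (x + h *\<^sub>R axis i 1) - f (x + h *\<^sub>R axis j 1) + f x = h * h * ?b y"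
    using second_difference_eq_mixed_partial[of x r f i h j] df h by blast
  obtain z where z: "dist x z \<le> 2 * h" "f (x + h *\<^sub>R axis j 1 + h *\<^sub>R axis i 1)
      - f (x + h *\<^sub>R axis j 1) - f (x + h *\<^sub>R axis i 1) + f x = h * h * ?a z"
    using second_difference_eq_mixed_partial[of x r f j h i] df h by blast
  have "h * h * ?b y = h * h * ?a z"
    using y(2) z(2) by (simp add: add.commute add.left_commute algebra_simps)
  then have "?b y = ?a z" using h by simp
  moreover have "\<bar>?b y - ?b x\<bar> < e" "\<bar>?a z - ?a x\<bar> < e"
    using db(2)[of y] da(2)[of z] y(1) z(1) h by (auto simp: dist_commute dist_real_def)
  ultimately show False by (simp add: e_def field_simps abs_if split: if_splits)
qed

lemma Cinf_on_compose:
  fixes f :: "real^'n::finite \<Rightarrow> real" and \<phi> :: "real^'m::finite \<Rightarrow> real^'n"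
  assumes "open V" "open W" "\<phi> ` V \<subseteq> W" "Cinf_on W f" "\<And>m. Cinf_on V (\<lambda>x. \<phi> x $ m)"
  shows "Cinf_on V (\<lambda>x. f (\<phi> x))"
  using assms(4,5) Ck_on_compose[OF assms(1-3)] unfolding Cinf_on_def by (simp del: Ck_on.simps)

lemma Cinf_on_cong_open:
  assumes "open V" "\<And>x. x \<in> V \<Longrightarrow> f x = h x" "Cinf_on V f"
  shows "Cinf_on V h"
  using assms Ck_on_cong_open[of V f h] by (auto simp: Cinf_on_def)

lemma Cinf_on_subset: "Cinf_on W f \<Longrightarrow> V \<subseteq> W \<Longrightarrow> Cinf_on V f"
  unfolding Cinf_on_def by (metis Ck_on_subset)

section \<open>Smooth functions on a manifold, seen in one chart\<close>

lemma homeomorphism_chart: "is_chart d \<Longrightarrow> homeomorphism (fst d) (snd d ` fst d) (snd d) (chart_inv d)"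
  by (simp add: is_chart_def)

lemma chart_inv_chart: "is_chart d \<Longrightarrow> q \<in> fst d \<Longrightarrow> chart_inv d (snd d q) = q"
  using homeomorphism_chart[of d] by (simp add: homeomorphism_def)

lemma open_chart_image:
  assumes d: "is_chart d" and W: "open W"
  shows "open (snd d ` (fst d \<inter> W))"
proof -
  have "openin (top_of_set (fst d)) (fst d \<inter> W)"
    using W by (rule openin_open_Int)
  then have "openin (top_of_set (snd d ` fst d)) (snd d ` (fst d \<inter> W))"
    by (rule homeomorphism_imp_open_map[OF homeomorphism_chart[OF d]])
  then show ?thesis
    using d by (auto simp: is_chart_def intro: openin_open_trans)
qed

lemma smooth_fun_open: "smooth_fun A W f \<Longrightarrow> open W"
  by (simp add: smooth_fun_def)

locale smooth_chart =
  fixes A :: "('m::{t2_space,second_countable_topology}, 'n::finite) chart set"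
    and c :: "('m, 'n) chart"
  assumes atlas: "smooth_structure A" and c_in: "c \<in> A"
begin

abbreviation "U \<equiv> fst c"

text \<open>Tangent vectors act on functions, so \<open>pd k p f\<close> is the partial derivative of \<open>f\<close> along the
  \<open>k\<close>-th coordinate, and \<open>pd k\<close> alone is the coordinate field.\<close>

abbreviation "pd \<equiv> coord_field A c"

lemma is_chart_atlas: "d \<in> A \<Longrightarrow> is_chart d"
  using atlas by (simp add: smooth_structure_def)

lemma chart_c: "is_chart c"
  using c_in by (rule is_chart_atlas)

lemma open_U: "open U"
  using chart_c by (simp add: is_chart_def)

lemma open_image_c: "open W \<Longrightarrow> W \<subseteq> U \<Longrightarrow> open (snd c ` W)"
  using open_chart_image[OF chart_c, of W] by (simp add: Int_absorb1)

lemma transition_Cinf_on: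
  assumes "d \<in> A" "V \<subseteq> fst d \<inter> U"
  shows "Cinf_on (snd d ` V) (\<lambda>x. snd c (chart_inv d x) $ m)"
proof -
  have "Cinf_on (snd d ` (fst d \<inter> U)) (\<lambda>x. snd c (chart_inv d x) $ m)"
    using atlas assms(1) c_in unfolding smooth_structure_def smooth_transition_def by blast
  then show ?thesis by (rule Cinf_on_subset) (use assms(2) in blast)
qed

text \<open>Because transition maps are smooth, smoothness on a subset of the chart domain can be
  tested in the single chart \<open>c\<close>.\<close>

lemma smooth_fun_iff_chart:
  assumes W: "open W" "W \<subseteq> U"
  shows "smooth_fun A W f \<longleftrightarrow> Cinf_on (snd c ` W) (\<lambda>x. f (chart_inv c x))"
proof
  assume "smooth_fun A W f"
  then have "Cinf_on (snd c ` (U \<inter> W)) (\<lambda>x. f (chart_inv c x))"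
    using c_in unfolding smooth_fun_def by blast
  then show "Cinf_on (snd c ` W) (\<lambda>x. f (chart_inv c x))"
    using W(2) by (simp add: Int_absorb1)
next
  assume f: "Cinf_on (snd c ` W) (\<lambda>x. f (chart_inv c x))"
  have "Cinf_on (snd d ` (fst d \<inter> W)) (\<lambda>x. f (chart_inv d x))" if d: "d \<in> A" for d
  proof -
    let ?V = "snd d ` (fst d \<inter> W)"
    have inv_d: "chart_inv d (snd d q) = q" if "q \<in> fst d" for q
      using chart_inv_chart[OF is_chart_atlas[OF d] that] .
    have V: "open ?V" by (rule open_chart_image[OF is_chart_atlas[OF d] W(1)])
    have "(\<lambda>x. snd c (chart_inv d x)) ` ?V \<subseteq> snd c ` W"
      using inv_d by auto
    moreover have "Cinf_on ?V (\<lambda>x. snd c (chart_inv d x) $ m)" for m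
      by (rule transition_Cinf_on[OF d]) (use W in blast)
    ultimately have "Cinf_on ?V (\<lambda>x. f (chart_inv c (snd c (chart_inv d x))))"
      by (rule Cinf_on_compose[OF V open_image_c[OF W] _ f])
    then show ?thesis
    proof (rule Cinf_on_cong_open[OF V, rotated])
      fix x assume "x \<in> ?V"
      then have "chart_inv d x \<in> U" using inv_d W by auto
      then show "f (chart_inv c (snd c (chart_inv d x))) = f (chart_inv d x)"
        by (simp add: chart_inv_chart[OF chart_c])
    qed
  qed
  then show "smooth_fun A W f" using W(1) by (simp add: smooth_fun_def)
qed

lemma smooth_fun_subset:
  assumes "smooth_fun A W f" "open V" "V \<subseteq> W"
  shows "smooth_fun A V f"
  using assms unfolding smooth_fun_def by (meson Cinf_on_subset Int_mono image_mono order_refl)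

lemma smooth_fun_cong:
  assumes W: "W \<subseteq> U" and eq: "\<And>q. q \<in> W \<Longrightarrow> f q = h q" and f: "smooth_fun A W f"
  shows "smooth_fun A W h"
proof -
  have W': "open W" using f by (rule smooth_fun_open)
  show ?thesis
    using f unfolding smooth_fun_iff_chart[OF W' W]
    by (rule Cinf_on_cong_open[OF open_image_c[OF W' W], rotated])
      (use eq W chart_inv_chart[OF chart_c] in force)
qed

lemma smooth_fun_const: "open W \<Longrightarrow> smooth_fun A W (\<lambda>q. a)"
  by (simp add: smooth_fun_def Cinf_on_def Ck_on_const)

lemma smooth_fun_add:
  assumes "smooth_fun A W f" "smooth_fun A W h"
  shows "smooth_fun A W (\<lambda>q. f q + h q)"
  unfolding smooth_fun_def Cinf_on_def
proof (intro conjI ballI allI)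
  show W: "open W" using assms(1) by (rule smooth_fun_open)
  fix d k assume d: "d \<in> A"
  show "Ck_on k (snd d ` (fst d \<inter> W)) (\<lambda>x. f (chart_inv d x) + h (chart_inv d x))"
    by (rule Ck_on_add[OF open_chart_image[OF is_chart_atlas[OF d] W]])
      (use assms d in \<open>simp_all add: smooth_fun_def Cinf_on_def\<close>)
qed

lemma smooth_fun_mult:
  assumes "smooth_fun A W f" "smooth_fun A W h"
  shows "smooth_fun A W (\<lambda>q. f q * h q)"
  unfolding smooth_fun_def Cinf_on_def
proof (intro conjI ballI allI)
  show W: "open W" using assms(1) by (rule smooth_fun_open)
  fix d k assume d: "d \<in> A"
  show "Ck_on k (snd d ` (fst d \<inter> W)) (\<lambda>x. f (chart_inv d x) * h (chart_inv d x))"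
    by (rule Ck_on_mult[OF open_chart_image[OF is_chart_atlas[OF d] W]])
      (use assms d in \<open>simp_all add: smooth_fun_def Cinf_on_def\<close>)
qed

lemma smooth_fun_cmult: "smooth_fun A W f \<Longrightarrow> smooth_fun A W (\<lambda>q. a * f q)"
  by (intro smooth_fun_mult smooth_fun_const) (auto dest: smooth_fun_open)

lemma smooth_fun_minus: "smooth_fun A W f \<Longrightarrow> smooth_fun A W (\<lambda>q. - f q)"
  using smooth_fun_cmult[of W f "-1"] by simp

lemma smooth_fun_sum:
  assumes "open W" "\<And>a. a \<in> F \<Longrightarrow> smooth_fun A W (f a)"
  shows "smooth_fun A W (\<lambda>q. \<Sum>a\<in>F. f a q)"
  using assms(2) by (induction F rule: infinite_finite_induct)
    (auto intro: smooth_fun_const[OF assms(1)] smooth_fun_add)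

lemma smooth_fun_prod:
  assumes "open W" "\<And>a. a \<in> F \<Longrightarrow> smooth_fun A W (f a)"
  shows "smooth_fun A W (\<lambda>q. \<Prod>a\<in>F. f a q)"
  using assms(2) by (induction F rule: infinite_finite_induct)
    (auto intro: smooth_fun_const[OF assms(1)] smooth_fun_mult)

lemma smooth_fun_inverse:
  assumes W: "W \<subseteq> U" and f: "smooth_fun A W f" and nz: "\<And>q. q \<in> W \<Longrightarrow> f q \<noteq> 0"
  shows "smooth_fun A W (\<lambda>q. inverse (f q))"
proof -
  have W': "open W" using f by (rule smooth_fun_open)
  have "f (chart_inv c x) \<noteq> 0" if "x \<in> snd c ` W" for x
    using that nz W chart_inv_chart[OF chart_c] by force
  then show ?thesis
    using f Ck_on_inverse[OF open_image_c[OF W' W], of "\<lambda>x. f (chart_inv c x)"]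
    unfolding smooth_fun_iff_chart[OF W' W] Cinf_on_def by blast
qed

lemma smooth_nearI: "smooth_fun A W f \<Longrightarrow> p \<in> W \<Longrightarrow> smooth_near A p f"
  by (auto simp: smooth_near_def)

lemma smooth_nearE:
  assumes "smooth_near A p f" "p \<in> U"
  obtains W where "p \<in> W" "W \<subseteq> U" "smooth_fun A W f"
proof -
  obtain W where W: "p \<in> W" "smooth_fun A W f"
    using assms(1) by (auto simp: smooth_near_def)
  show ?thesis
    by (rule that[of "W \<inter> U"])
      (use W assms(2) open_U smooth_fun_open[OF W(2)] smooth_fun_subset[OF W(2), of "W \<inter> U"] in auto)
qed

text \<open>Tangent vectors vanish by convention on functions that are not smooth near their base
  point, so that locality of coordinate derivatives needs locality of smoothness first.\<close>

lemma smooth_near_cong: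
  assumes W: "open W" "p \<in> W" "W \<subseteq> U" and eq: "\<And>q. q \<in> W \<Longrightarrow> f q = h q"
  shows "smooth_near A p f \<longleftrightarrow> smooth_near A p h"
proof -
  have "smooth_near A p h" if near: "smooth_near A p f" and eq: "\<And>q. q \<in> W \<Longrightarrow> f q = h q" for f h
  proof -
    have p: "p \<in> U" using W by blast
    obtain V where V: "p \<in> V" "V \<subseteq> U" "smooth_fun A V f"
      by (rule smooth_nearE[OF near p])
    have "smooth_fun A (V \<inter> W) f"
      by (rule smooth_fun_subset[OF V(3)]) (use W smooth_fun_open[OF V(3)] in auto)
    then have "smooth_fun A (V \<inter> W) h"
      by (rule smooth_fun_cong[rotated 2]) (use V W eq in auto)
    then show ?thesis using V W by (auto intro: smooth_nearI)
  qed
  then show ?thesis using eq by metis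
qed

lemma smooth_coordinate: "smooth_fun A U (\<lambda>q. snd c q $ m)"
  unfolding smooth_fun_def using open_U transition_Cinf_on by simp

lemma smooth_imp_differentiable:
  assumes "smooth_near A p f" "d \<in> A" "p \<in> fst d"
  shows "(\<lambda>x. f (chart_inv d x)) differentiable (at (snd d p))"
proof -
  obtain W where W: "p \<in> W" "smooth_fun A W f"
    using assms(1) by (auto simp: smooth_near_def)
  then have "Cinf_on (snd d ` (fst d \<inter> W)) (\<lambda>x. f (chart_inv d x))"
    using assms(2) by (simp add: smooth_fun_def)
  then show ?thesis
    by (rule Cinf_on_differentiable)
      (use open_chart_image[OF is_chart_atlas[OF assms(2)] smooth_fun_open[OF W(2)]] assms W in auto)
qed

section \<open>Coordinate derivatives\<close>

lemma coord_field_eq: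
  "pd k p f = (if smooth_near A p f then partial_deriv k (\<lambda>x. f (chart_inv c x)) (snd c p) else 0)"
  by (simp add: coord_field_def coord_vec_def partial_deriv_def)

lemma coord_field_cong:
  assumes W: "open W" "p \<in> W" "W \<subseteq> U" and eq: "\<And>q. q \<in> W \<Longrightarrow> f q = h q"
  shows "pd k p f = pd k p h"
proof -
  have "partial_deriv k (\<lambda>x. f (chart_inv c x)) (snd c p)
      = partial_deriv k (\<lambda>x. h (chart_inv c x)) (snd c p)"
    by (rule partial_deriv_cong_open[OF open_image_c[OF W(1,3)]])
      (use W eq chart_inv_chart[OF chart_c] in force)+
  then show ?thesis using smooth_near_cong[OF assms] by (simp add: coord_field_eq)
qed

lemma coord_field_const: "pd k p (\<lambda>q. a) = 0"
  by (simp add: coord_field_eq partial_deriv_const)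

lemma coord_field_add:
  assumes "p \<in> W" "W \<subseteq> U" "smooth_fun A W f" "smooth_fun A W h"
  shows "pd k p (\<lambda>q. f q + h q) = pd k p f + pd k p h"
  using assms smooth_nearI[OF assms(3,1)] smooth_nearI[OF assms(4,1)]
    smooth_nearI[OF smooth_fun_add[OF assms(3,4)] assms(1)]
  by (auto simp: coord_field_eq c_in intro!: partial_deriv_add smooth_imp_differentiable)

lemma coord_field_mult:
  assumes "p \<in> W" "W \<subseteq> U" "smooth_fun A W f" "smooth_fun A W h"
  shows "pd k p (\<lambda>q. f q * h q) = f p * pd k p h + pd k p f * h p"
proof -
  have p: "p \<in> U" using assms by blast
  note near = smooth_nearI[OF assms(3,1)] smooth_nearI[OF assms(4,1)]
    smooth_nearI[OF smooth_fun_mult[OF assms(3,4)] assms(1)]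
  show ?thesis
    using partial_deriv_mult[OF near(1,2)[THEN smooth_imp_differentiable[OF _ c_in p]]]
    by (simp add: coord_field_eq near chart_inv_chart[OF chart_c p])
qed

lemma coord_field_cmult:
  assumes "p \<in> W" "W \<subseteq> U" "smooth_fun A W f"
  shows "pd k p (\<lambda>q. a * f q) = a * pd k p f"
  using coord_field_mult[OF assms(1,2) smooth_fun_const[OF smooth_fun_open[OF assms(3)]] assms(3)]
  by (simp add: coord_field_const)

lemma coord_field_diff:
  assumes "p \<in> W" "W \<subseteq> U" "smooth_fun A W f" "smooth_fun A W h"
  shows "pd k p (\<lambda>q. f q - h q) = pd k p f - pd k p h"
  using coord_field_add[OF assms(1-3) smooth_fun_minus[OF assms(4)]]
    coord_field_cmult[OF assms(1,2,4), of k "-1"] by simp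

lemma coord_field_sum:
  assumes "p \<in> W" "W \<subseteq> U" "open W" "\<And>a. a \<in> F \<Longrightarrow> smooth_fun A W (f a)"
  shows "pd k p (\<lambda>q. \<Sum>a\<in>F. f a q) = (\<Sum>a\<in>F. pd k p (f a))"
  using assms(4)
proof (induction F rule: infinite_finite_induct)
  case (insert a F)
  then show ?case
    using coord_field_add[OF assms(1,2), of "f a" "\<lambda>q. \<Sum>a\<in>F. f a q"] smooth_fun_sum[OF assms(3), of F f]
    by simp
qed (simp_all add: coord_field_const)

lemma coord_field_pullback:
  assumes "W \<subseteq> U" "smooth_fun A W f" "x \<in> snd c ` W"
  shows "pd k (chart_inv c x) f = partial_deriv k (\<lambda>x. f (chart_inv c x)) x"
proof -
  obtain q where q: "q \<in> W" "x = snd c q" using assms(3) by blast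
  have qi: "chart_inv c (snd c q) = q"
    using q assms(1) chart_inv_chart[OF chart_c] by blast
  show ?thesis
    using smooth_nearI[OF assms(2) q(1)] qi q by (simp add: coord_field_eq)
qed

lemma smooth_coord_field:
  assumes "W \<subseteq> U" "smooth_fun A W f"
  shows "smooth_fun A W (\<lambda>q. pd k q f)"
proof -
  have W': "open W" using assms(2) by (rule smooth_fun_open)
  have "Cinf_on (snd c ` W) (partial_deriv k (\<lambda>x. f (chart_inv c x)))"
    using assms(2) unfolding smooth_fun_iff_chart[OF W' assms(1)] by (rule Cinf_on_partial_deriv)
  then show ?thesis
    unfolding smooth_fun_iff_chart[OF W' assms(1)]
    by (rule Cinf_on_cong_open[OF open_image_c[OF W' assms(1)], rotated])
      (simp add: coord_field_pullback[OF assms])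
qed

lemma coord_field_commute:
  assumes "p \<in> W" "W \<subseteq> U" "smooth_fun A W f"
  shows "pd k p (\<lambda>q. pd l q f) = pd l p (\<lambda>q. pd k q f)"
proof -
  have W': "open W" using assms(3) by (rule smooth_fun_open)
  let ?F = "\<lambda>x. f (chart_inv c x)"
  have F: "Cinf_on (snd c ` W) ?F"
    using assms(3) unfolding smooth_fun_iff_chart[OF W' assms(2)] .
  have *: "pd k p (\<lambda>q. pd l q f) = partial_deriv k (partial_deriv l ?F) (snd c p)" for k l
  proof -
    have "pd k p (\<lambda>q. pd l q f) = partial_deriv k (\<lambda>x. pd l (chart_inv c x) f) (snd c p)"
      using smooth_nearI[OF smooth_coord_field[OF assms(2,3)] assms(1)] by (simp add: coord_field_eq)
    also have "\<dots> = partial_deriv k (partial_deriv l ?F) (snd c p)"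
      by (rule partial_deriv_cong_open[OF open_image_c[OF W' assms(2)]])
        (use assms(1) coord_field_pullback[OF assms(2,3)] in auto)
    finally show ?thesis .
  qed
  show ?thesis
    using partial_deriv_commute[OF F open_image_c[OF W' assms(2)]] assms(1) by (simp add: *)
qed

lemma coord_field_coordinate:
  assumes "p \<in> U"
  shows "pd k p (\<lambda>q. snd c q $ m) = (if m = k then 1 else 0)"
proof -
  have "partial_deriv k (\<lambda>x. snd c (chart_inv c x) $ m) (snd c p) = partial_deriv k (\<lambda>x. x $ m) (snd c p)"
    by (rule partial_deriv_cong_open[OF open_image_c[OF open_U order_refl]])
      (use assms chart_inv_chart[OF chart_c] in auto)
  then show ?thesis
    using smooth_nearI[OF smooth_coordinate assms] by (simp add: coord_field_eq partial_deriv_component)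
qed

section \<open>Tangent vectors and vector fields in the chart\<close>

text \<open>The chain rule, applied to the transition from another chart to \<open>c\<close>, expresses every
  tangent vector by the coordinate vectors of \<open>c\<close>.\<close>

lemma tangent_expansion:
  assumes p: "p \<in> U" and v: "v \<in> tangent_space A p"
  shows "v = (\<lambda>f. \<Sum>m\<in>UNIV. vec_comp c v m * pd m p f)"
proof
  fix f
  obtain d a where d: "d \<in> A" "p \<in> fst d" and va: "v = coord_vec A d p a"
    using v by (auto simp: tangent_space_def)
  show "v f = (\<Sum>m\<in>UNIV. vec_comp c v m * pd m p f)"
  proof (cases "smooth_near A p f")
    case False
    then show ?thesis by (simp add: va coord_vec_def coord_field_def)
  next
    case True
    let ?\<phi> = "\<lambda>x. snd c (chart_inv d x)" and ?x = "snd d p"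
    have d': "is_chart d" using d is_chart_atlas by blast
    have x: "?\<phi> ?x = snd c p" by (simp add: chart_inv_chart[OF d' d(2)])
    have comp: "vec_comp c v m = frechet_derivative (\<lambda>x. ?\<phi> x $ m) (at ?x) a" for m
      using smooth_nearI[OF smooth_coordinate p] by (simp add: vec_comp_def va coord_vec_def)
    have "v f = frechet_derivative (\<lambda>x. f (chart_inv d x)) (at ?x) a"
      using True by (simp add: va coord_vec_def)
    also have "frechet_derivative (\<lambda>x. f (chart_inv d x)) (at ?x)
        = frechet_derivative (\<lambda>x. f (chart_inv c (?\<phi> x))) (at ?x)"
    proof (rule frechet_derivative_cong_open[OF open_chart_image[OF d' open_U]])
      show "?x \<in> snd d ` (fst d \<inter> U)" using d p by blast
      show "f (chart_inv d y) = f (chart_inv c (?\<phi> y))" if "y \<in> snd d ` (fst d \<inter> U)" for y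
        using that chart_inv_chart[OF d'] chart_inv_chart[OF chart_c] by auto
    qed
    also have "frechet_derivative (\<lambda>x. f (chart_inv c (?\<phi> x))) (at ?x) a
        = (\<Sum>m\<in>UNIV. frechet_derivative (\<lambda>x. ?\<phi> x $ m) (at ?x) a
             * partial_deriv m (\<lambda>x. f (chart_inv c x)) (?\<phi> ?x))"
      by (rule frechet_derivative_chain(2))
        (use smooth_imp_differentiable[OF True c_in p] x
          smooth_imp_differentiable[OF smooth_nearI[OF smooth_coordinate p] d] in auto)
    also have "\<dots> = (\<Sum>m\<in>UNIV. vec_comp c v m * pd m p f)"
      using True by (simp add: comp x chart_inv_chart[OF d' d(2)] coord_field_eq)
    finally show ?thesis .
  qed
qed

lemma vec_comp_expansion:
  assumes "p \<in> U"
  shows "vec_comp c (\<lambda>f. \<Sum>m\<in>UNIV. a m * pd m p f) i = a i"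
  by (simp add: vec_comp_def coord_field_coordinate[OF assms] if_distrib cong: if_cong)

lemma expansion_in_tangent_space:
  assumes "p \<in> U"
  shows "(\<lambda>f. \<Sum>m\<in>UNIV. a m * pd m p f) \<in> tangent_space A p"
proof -
  have "coord_vec A c p (\<chi> m. a m) = (\<lambda>f. \<Sum>m\<in>UNIV. a m * pd m p f)"
    using smooth_imp_differentiable[OF _ c_in assms]
    by (auto simp: fun_eq_iff coord_vec_def coord_field_eq frechet_derivative_partial)
  then show ?thesis
    unfolding tangent_space_def mem_Collect_eq
    by (intro exI[of _ c] exI[of _ "\<chi> m. a m"] conjI) (use c_in assms in simp_all)
qed

lemma coord_field_in_tangent_space: "p \<in> U \<Longrightarrow> pd k p \<in> tangent_space A p"
  unfolding tangent_space_def coord_field_def using c_in by blast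

lemma tangent_space_add:
  assumes "p \<in> U" "u \<in> tangent_space A p" "v \<in> tangent_space A p"
  shows "(\<lambda>f. u f + v f) \<in> tangent_space A p"
proof -
  obtain a b where "u = (\<lambda>f. \<Sum>m\<in>UNIV. a m * pd m p f)" "v = (\<lambda>f. \<Sum>m\<in>UNIV. b m * pd m p f)"
    using tangent_expansion assms by blast
  then have "(\<lambda>f. u f + v f) = (\<lambda>f. \<Sum>m\<in>UNIV. (a m + b m) * pd m p f)"
    by (simp add: sum.distrib distrib_right)
  then show ?thesis using expansion_in_tangent_space[OF assms(1)] by simp
qed

lemma tangent_space_scale:
  assumes "p \<in> U" "u \<in> tangent_space A p"
  shows "(\<lambda>f. a * u f) \<in> tangent_space A p"
proof -
  obtain b where "u = (\<lambda>f. \<Sum>m\<in>UNIV. b m * pd m p f)"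
    using tangent_expansion assms by blast
  then have "(\<lambda>f. a * u f) = (\<lambda>f. \<Sum>m\<in>UNIV. (a * b m) * pd m p f)"
    by (simp add: sum_distrib_left mult.assoc)
  then show ?thesis using expansion_in_tangent_space[OF assms(1)] by simp
qed

lemma smooth_vf_comp: "smooth_vf A U X \<Longrightarrow> smooth_fun A U (\<lambda>q. vec_comp c (X q) m)"
  using smooth_coordinate unfolding smooth_vf_def vec_comp_def by blast

lemma smooth_vf_tangent: "smooth_vf A U X \<Longrightarrow> q \<in> U \<Longrightarrow> X q \<in> tangent_space A q"
  by (simp add: smooth_vf_def)

lemma smooth_vf_coord_field: "smooth_vf A U (pd k)"
  using open_U coord_field_in_tangent_space smooth_coord_field by (simp add: smooth_vf_def)

lemma smooth_vf_add: "smooth_vf A U X \<Longrightarrow> smooth_vf A U Y \<Longrightarrow> smooth_vf A U (vf_add X Y)"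
  using tangent_space_add by (simp add: smooth_vf_def vf_add_def smooth_fun_add)

lemma smooth_vf_scale:
  assumes "smooth_fun A U h" "smooth_vf A U X"
  shows "smooth_vf A U (vf_scale h X)"
  using assms tangent_space_scale smooth_fun_subset[OF assms(1)]
  by (auto simp: smooth_vf_def vf_scale_def intro!: smooth_fun_mult dest: smooth_fun_open)

lemma vec_comp_diff: "vec_comp c (vf_diff X Y q) m = vec_comp c (X q) m - vec_comp c (Y q) m"
  by (simp add: vec_comp_def vf_diff_def)

lemma vec_comp_coord_field: "q \<in> U \<Longrightarrow> vec_comp c (pd k q) m = (if m = k then 1 else 0)"
  by (simp add: vec_comp_def coord_field_coordinate)

lemma smooth_vf_diff:
  assumes "smooth_vf A U X" "smooth_vf A U Y"
  shows "smooth_vf A U (vf_diff X Y)"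
proof -
  have "vf_diff X Y = vf_add X (vf_scale (\<lambda>q. - 1) Y)"
    by (simp add: vf_diff_def vf_add_def vf_scale_def)
  then show ?thesis
    using assms smooth_vf_add smooth_vf_scale[OF smooth_fun_const[OF open_U]] by simp
qed

lemma smooth_vf_cong:
  assumes "smooth_vf A U X" "\<And>q. q \<in> U \<Longrightarrow> X q = Y q"
  shows "smooth_vf A U Y"
  unfolding smooth_vf_def
proof (intro conjI ballI allI impI)
  show "open U" by (rule open_U)
  show "Y q \<in> tangent_space A q" if "q \<in> U" for q
    using that smooth_vf_tangent[OF assms(1) that] assms(2)[OF that] by simp
  fix V f assume V: "V \<subseteq> U \<and> smooth_fun A V f"
  then have "smooth_fun A V (\<lambda>q. X q f)" using assms(1) by (simp add: smooth_vf_def)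
  then show "smooth_fun A V (\<lambda>q. Y q f)"
    by (rule smooth_fun_cong[rotated 2]) (use V assms(2) in auto)
qed

lemma lie_bracket_coord_field:
  assumes "p \<in> U"
  shows "lie_bracket A (pd k) (pd l) p = (\<lambda>f. 0)"
proof
  fix f
  show "lie_bracket A (pd k) (pd l) p f = 0"
  proof (cases "smooth_near A p f")
    case True
    then obtain W where W: "p \<in> W" "W \<subseteq> U" "smooth_fun A W f"
      by (rule smooth_nearE[OF _ assms])
    show ?thesis
      using True coord_field_commute[OF W, of k l] by (simp add: lie_bracket_def)
  qed (simp add: lie_bracket_def)
qed

end

section \<open>Connections in the chart\<close>

locale chart_connection = smooth_chart A c
  for A :: "('m::{t2_space,second_countable_topology}, 'n::finite) chart set"
    and c :: "('m, 'n) chart" +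
  fixes D :: "'m vfield \<Rightarrow> 'm vfield \<Rightarrow> 'm vfield"
  assumes conn: "affine_connection A D"
begin

abbreviation "\<Gamma> \<equiv> christoffel A c D"

abbreviation "Rm \<equiv> curv_comp A c D"

abbreviation "Ric \<equiv> ricci A c D"

lemma conn_cong:
  assumes "smooth_vf A U X" "smooth_vf A U X'" "smooth_vf A U Y" "smooth_vf A U Y'"
    and "\<And>q. q \<in> U \<Longrightarrow> X q = X' q" "\<And>q. q \<in> U \<Longrightarrow> Y q = Y' q" and "p \<in> U"
  shows "D X Y p = D X' Y' p"
  using conn[unfolded affine_connection_def, THEN conjunct1, rule_format, of U X X' Y Y' p] assms
  by blast

lemma conn_smooth: "smooth_vf A U X \<Longrightarrow> smooth_vf A U Y \<Longrightarrow> smooth_vf A U (D X Y)"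
  using conn[unfolded affine_connection_def, THEN conjunct2, THEN conjunct1, rule_format, of U X Y]
  by blast

lemma conn_scale1:
  "smooth_fun A U h \<Longrightarrow> smooth_vf A U X \<Longrightarrow> smooth_vf A U Y \<Longrightarrow> p \<in> U \<Longrightarrow>
    D (vf_scale h X) Y p = vf_scale h (D X Y) p"
  using conn[unfolded affine_connection_def, THEN conjunct2, THEN conjunct2, THEN conjunct2,
      THEN conjunct1, rule_format, of U h X Y p]
  by blast

lemma conn_add2:
  "smooth_vf A U X \<Longrightarrow> smooth_vf A U Y \<Longrightarrow> smooth_vf A U Y' \<Longrightarrow> p \<in> U \<Longrightarrow>
    D X (vf_add Y Y') p = vf_add (D X Y) (D X Y') p"
  using conn[unfolded affine_connection_def, THEN conjunct2, THEN conjunct2, THEN conjunct2,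
      THEN conjunct2, THEN conjunct1, rule_format, of U X Y Y' p]
  by blast

lemma conn_scale2:
  "smooth_fun A U h \<Longrightarrow> smooth_vf A U X \<Longrightarrow> smooth_vf A U Y \<Longrightarrow> p \<in> U \<Longrightarrow>
    D X (vf_scale h Y) p = vf_add (vf_scale (\<lambda>q. X q h) Y) (vf_scale h (D X Y)) p"
  using conn[unfolded affine_connection_def, THEN conjunct2, THEN conjunct2, THEN conjunct2,
      THEN conjunct2, THEN conjunct2, rule_format, of U h X Y p]
  by blast

text \<open>The axioms of a connection speak about sums of two fields and about multiples of a field,
  hence the induction on the number of coordinate fields. The empty sum is the zero multiple of
  some field.\<close>

lemma conn_expansion:
  assumes X: "smooth_vf A U X" and a: "\<And>m. smooth_fun A U (a m)" and p: "p \<in> U" and F: "finite F"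
  shows "smooth_vf A U (\<lambda>q f. \<Sum>m\<in>F. a m q * pd m q f)
    \<and> D X (\<lambda>q f. \<Sum>m\<in>F. a m q * pd m q f) p
      = (\<lambda>f. \<Sum>m\<in>F. X p (a m) * pd m p f + a m p * D X (pd m) p f)"
  using F
proof (induction F rule: finite_induct)
  case empty
  have z: "(\<lambda>q f. \<Sum>m\<in>{}. a m q * pd m q f) = vf_scale (\<lambda>q. 0) X"
    by (simp add: vf_scale_def)
  have "X p (\<lambda>q. 0) = 0"
    by (subst tangent_expansion[OF p smooth_vf_tangent[OF X p]]) (simp add: coord_field_const)
  then show ?case
    unfolding z using smooth_vf_scale[OF smooth_fun_const[OF open_U, of 0] X]
      conn_scale2[OF smooth_fun_const[OF open_U] X X p, of 0]
    by (simp add: vf_add_def vf_scale_def)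
next
  case (insert m F)
  let ?Y = "\<lambda>q f. \<Sum>m\<in>F. a m q * pd m q f"
  have e: "(\<lambda>q f. \<Sum>m\<in>insert m F. a m q * pd m q f) = vf_add (vf_scale (a m) (pd m)) ?Y"
    using insert by (simp add: vf_add_def vf_scale_def)
  have s: "smooth_vf A U (vf_scale (a m) (pd m))" "smooth_vf A U ?Y"
    using insert smooth_vf_scale[OF a smooth_vf_coord_field] by auto
  show ?case
    unfolding e using insert smooth_vf_add[OF s] conn_add2[OF X s p]
      conn_scale2[OF a X smooth_vf_coord_field p]
    by (simp add: vf_add_def vf_scale_def)
qed

text \<open>Expanding \<open>Z\<close> in the coordinate fields, the Leibniz rule gives
  $(\nabla_k Z)^i = \partial_k Z^i + \Gamma^i_{km} Z^m$. Through this formula a connection enters all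
  computations with components.\<close>

lemma conn_comp:
  assumes Z: "smooth_vf A U Z" and p: "p \<in> U"
  shows "vec_comp c (D (pd k) Z p) i
    = pd k p (\<lambda>q. vec_comp c (Z q) i) + (\<Sum>m\<in>UNIV. \<Gamma> i k m p * vec_comp c (Z p) m)"
proof -
  let ?Y = "\<lambda>q f. \<Sum>m\<in>UNIV. vec_comp c (Z q) m * pd m q f"
  note E = conn_expansion[of "pd k" "\<lambda>m q. vec_comp c (Z q) m" p UNIV,
      OF smooth_vf_coord_field smooth_vf_comp[OF Z] p finite]
  have "D (pd k) Z p = D (pd k) ?Y p"
    using conjunct1[OF E] tangent_expansion[OF _ smooth_vf_tangent[OF Z]]
    by (intro conn_cong[OF smooth_vf_coord_field smooth_vf_coord_field Z _ _ _ p]) auto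
  then have "vec_comp c (D (pd k) Z p) i = (\<Sum>m\<in>UNIV. pd k p (\<lambda>q. vec_comp c (Z q) m) * vec_comp c (pd m p) i
      + vec_comp c (Z p) m * \<Gamma> i k m p)"
    using conjunct2[OF E] by (simp add: vec_comp_def christoffel_def)
  then show ?thesis
    unfolding sum.distrib vec_comp_coord_field[OF p]
    by (simp add: if_distrib mult.commute cong: if_cong)
qed

lemma smooth_christoffel: "smooth_fun A U (\<Gamma> i k l)"
  unfolding christoffel_def[abs_def]
  by (intro smooth_vf_comp conn_smooth smooth_vf_coord_field)

lemma conn_comp_diff:
  assumes Z: "smooth_vf A U Y" "smooth_vf A U Z" and p: "p \<in> U"
  shows "vec_comp c (D (pd k) (vf_diff Y Z) p) i
    = vec_comp c (D (pd k) Y p) i - vec_comp c (D (pd k) Z p) i"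
  by (simp add: conn_comp[OF _ p] smooth_vf_diff assms vec_comp_diff sum_subtractf right_diff_distrib
      coord_field_diff[OF p order_refl smooth_vf_comp smooth_vf_comp])

subsection \<open>Curvature\<close>

text \<open>The commutator $[\nabla_k, \nabla_l]$ of covariant derivatives along coordinate fields.\<close>

definition curv_op :: "'n \<Rightarrow> 'n \<Rightarrow> 'm vfield \<Rightarrow> 'm vfield" where
  "curv_op k l Z = vf_diff (D (pd k) (D (pd l) Z)) (D (pd l) (D (pd k) Z))"

lemma smooth_curv_op: "smooth_vf A U Z \<Longrightarrow> smooth_vf A U (curv_op k l Z)"
  unfolding curv_op_def by (intro smooth_vf_diff conn_smooth smooth_vf_coord_field)

text \<open>Coordinate fields commute, so the term with their Lie bracket drops out of the
  curvature.\<close>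

lemma curvature_coord_field:
  assumes Z: "smooth_vf A U Z" and p: "p \<in> U"
  shows "curvature A D (pd k) (pd l) Z p = curv_op k l Z p"
proof -
  let ?O = "vf_scale (\<lambda>q. 0) (pd k)"
  have O: "smooth_vf A U ?O"
    by (intro smooth_vf_scale smooth_fun_const open_U smooth_vf_coord_field)
  have eq: "?O q = lie_bracket A (pd k) (pd l) q" if "q \<in> U" for q
    using lie_bracket_coord_field[OF that] by (simp add: vf_scale_def)
  have "D (lie_bracket A (pd k) (pd l)) Z p = D ?O Z p"
    by (intro conn_cong[OF smooth_vf_cong[OF O eq] O Z Z _ _ p]) (simp_all add: eq)
  also have "\<dots> = (\<lambda>f. 0)"
    using conn_scale1[OF smooth_fun_const[OF open_U, of 0] smooth_vf_coord_field Z p]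
    by (simp add: vf_scale_def)
  finally show ?thesis
    by (simp add: curvature_def curv_op_def vf_diff_def)
qed

lemma curv_comp_eq: "p \<in> U \<Longrightarrow> Rm i j k l p = vec_comp c (curv_op k l (pd i) p) j"
  unfolding curv_comp_def by (simp add: curvature_coord_field smooth_vf_coord_field)

lemma smooth_curv_comp: "smooth_fun A U (Rm i j k l)"
  by (rule smooth_fun_cong[OF order_refl curv_comp_eq[symmetric]])
    (auto intro: smooth_vf_comp smooth_curv_op smooth_vf_coord_field)

lemma smooth_ricci: "smooth_fun A U (Ric i j)"
  unfolding ricci_def[abs_def] by (intro smooth_fun_sum open_U smooth_curv_comp)

lemma curv_comp_antisym: "p \<in> U \<Longrightarrow> Rm i j l k p = - Rm i j k l p"
  by (simp add: curv_comp_eq curv_op_def vec_comp_diff)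

text \<open>Tensoriality: the terms in which a derivative hits the components of \<open>Z\<close> cancel, because
  coordinate derivatives commute.\<close>

lemma curv_op_comp:
  assumes Z: "smooth_vf A U Z" and p: "p \<in> U"
  shows "vec_comp c (curv_op k l Z p) j = (\<Sum>m\<in>UNIV. Rm m j k l p * vec_comp c (Z p) m)"
proof -
  define C where "C m = pd k p (\<Gamma> j l m) - pd l p (\<Gamma> j k m)
      + (\<Sum>r\<in>UNIV. \<Gamma> j k r p * \<Gamma> r l m p) - (\<Sum>r\<in>UNIV. \<Gamma> j l r p * \<Gamma> r k m p)" for m
  have second: "vec_comp c (D (pd k) (D (pd l) Z) p) j
      = pd k p (\<lambda>q. pd l q (\<lambda>q. vec_comp c (Z q) j))
      + (\<Sum>m\<in>UNIV. pd k p (\<Gamma> j l m) * vec_comp c (Z p) m)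
      + (\<Sum>m\<in>UNIV. \<Gamma> j l m p * pd k p (\<lambda>q. vec_comp c (Z q) m))
      + (\<Sum>m\<in>UNIV. \<Gamma> j k m p * pd l p (\<lambda>q. vec_comp c (Z q) m))
      + (\<Sum>m\<in>UNIV. (\<Sum>r\<in>UNIV. \<Gamma> j k r p * \<Gamma> r l m p) * vec_comp c (Z p) m)"
    if Z: "smooth_vf A U Z" for Z k l
  proof -
    note sz = smooth_vf_comp[OF Z]
    have "pd k p (\<lambda>q. vec_comp c (D (pd l) Z q) j)
        = pd k p (\<lambda>q. pd l q (\<lambda>q. vec_comp c (Z q) j) + (\<Sum>m\<in>UNIV. \<Gamma> j l m q * vec_comp c (Z q) m))"
      by (rule coord_field_cong[OF open_U p order_refl]) (rule conn_comp[OF Z])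
    also have "\<dots> = pd k p (\<lambda>q. pd l q (\<lambda>q. vec_comp c (Z q) j))
      + (\<Sum>m\<in>UNIV. pd k p (\<Gamma> j l m) * vec_comp c (Z p) m)
      + (\<Sum>m\<in>UNIV. \<Gamma> j l m p * pd k p (\<lambda>q. vec_comp c (Z q) m))"
      using p sz by (simp add: coord_field_add[OF p order_refl] coord_field_sum[OF p order_refl open_U]
          coord_field_mult[OF p order_refl] smooth_coord_field smooth_fun_sum[OF open_U] smooth_fun_mult
          smooth_christoffel sum.distrib)
    finally have 1: "pd k p (\<lambda>q. vec_comp c (D (pd l) Z q) j) = \<dots>" .
    have 2: "(\<Sum>m\<in>UNIV. \<Gamma> j k m p * (\<Sum>r\<in>UNIV. \<Gamma> m l r p * vec_comp c (Z p) r))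
        = (\<Sum>m\<in>UNIV. (\<Sum>r\<in>UNIV. \<Gamma> j k r p * \<Gamma> r l m p) * vec_comp c (Z p) m)"
      by (simp add: sum_distrib_left sum_distrib_right mult.assoc) (rule sum.swap)
    show ?thesis
      by (simp add: conn_comp[OF conn_smooth[OF smooth_vf_coord_field Z] p] conn_comp[OF Z p] 1
          distrib_left sum.distrib 2)
  qed
  have gen: "vec_comp c (curv_op k l Z p) j = (\<Sum>m\<in>UNIV. C m * vec_comp c (Z p) m)"
    if "smooth_vf A U Z" for Z
    using coord_field_commute[OF p order_refl smooth_vf_comp[OF that], of k l]
    by (simp add: curv_op_def vec_comp_diff second[OF that] C_def distrib_right left_diff_distrib
        sum.distrib sum_subtractf)
  have "Rm m j k l p = C m" for m
    using gen[OF smooth_vf_coord_field[of m]]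
    by (simp add: curv_comp_eq[OF p] vec_comp_coord_field[OF p] if_distrib cong: if_cong)
  then show ?thesis using gen[OF Z] by simp
qed

subsection \<open>The second Bianchi identity\<close>

lemma torsion_comp_eq: "p \<in> U \<Longrightarrow> torsion_comp A c D i k l p = \<Gamma> i k l p - \<Gamma> i l k p"
  using lie_bracket_coord_field
  by (simp add: torsion_comp_def torsion_def vec_comp_diff christoffel_def)
    (simp add: vec_comp_def)

text \<open>The covariant derivative $\nabla_h R_{l\ sj}^{\ k}$ of the curvature tensor.\<close>

definition cov_curv :: "'n \<Rightarrow> 'n \<Rightarrow> 'n \<Rightarrow> 'n \<Rightarrow> 'n \<Rightarrow> 'm \<Rightarrow> real" where
  "cov_curv h l k s j p = pd h p (Rm l k s j) + (\<Sum>m\<in>UNIV. \<Gamma> k h m p * Rm l m s j p)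
     - (\<Sum>m\<in>UNIV. \<Gamma> m h l p * Rm m k s j p)
     - (\<Sum>m\<in>UNIV. \<Gamma> m h s p * Rm l k m j p) - (\<Sum>m\<in>UNIV. \<Gamma> m h j p * Rm l k s m p)"

text \<open>Let $R_{sj} = [\nabla_s, \nabla_j]$. By the Jacobi identity, the cyclic sum of the commutators
  $[\nabla_h, R_{sj}]$ vanishes. In components on the coordinate field of index \<open>l\<close>, such a
  commutator is the covariant derivative of the curvature without the Christoffel terms for the
  two form indices, and in the cyclic sum those terms combine to the torsion.\<close>

lemma second_bianchi:
  assumes p: "p \<in> U"
  shows "cov_curv h l k s j p + cov_curv s l k j h p + cov_curv j l k h s p
    + (\<Sum>r\<in>UNIV. Rm l k r j p * torsion_comp A c D r h s p)
    + (\<Sum>r\<in>UNIV. Rm l k r h p * torsion_comp A c D r s j p)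
    + (\<Sum>r\<in>UNIV. Rm l k r s p * torsion_comp A c D r j h p) = 0"
proof -
  define B where "B h s j = pd h p (Rm l k s j) + (\<Sum>m\<in>UNIV. \<Gamma> k h m p * Rm l m s j p)
     - (\<Sum>m\<in>UNIV. \<Gamma> m h l p * Rm m k s j p)" for h s j
  note sl = smooth_vf_coord_field conn_smooth[OF smooth_vf_coord_field] smooth_vf_coord_field[of l]
  \<comment> \<open>tensoriality of the curvature turns \<open>R\<^sub>s\<^sub>j\<close> of the field \<open>\<nabla>\<^sub>h\<close> of the \<open>l\<close>-th coordinate field
    into the last term of \<open>B\<close>\<close>
  have comm: "vec_comp c (D (pd h) (curv_op s j (pd l)) p) k - vec_comp c (curv_op s j (D (pd h) (pd l)) p) k
      = B h s j" for h s j
  proof -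
    have "pd h p (\<lambda>q. vec_comp c (curv_op s j (pd l) q) k) = pd h p (Rm l k s j)"
      by (rule coord_field_cong[OF open_U p order_refl]) (simp add: curv_comp_eq)
    then show ?thesis
      by (simp add: conn_comp[OF smooth_curv_op[OF sl(1)] p] curv_op_comp[OF _ p] sl B_def
          curv_comp_eq[OF p, symmetric] christoffel_def[symmetric] mult.commute)
  qed
  have B: "B h s j = vec_comp c (D (pd h) (D (pd s) (D (pd j) (pd l))) p) k
      - vec_comp c (D (pd h) (D (pd j) (D (pd s) (pd l))) p) k
      - vec_comp c (D (pd s) (D (pd j) (D (pd h) (pd l))) p) k
      + vec_comp c (D (pd j) (D (pd s) (D (pd h) (pd l))) p) k" for h s j
    using comm[of h s j] by (simp add: curv_op_def vec_comp_diff conn_comp_diff[OF _ _ p] sl)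
  have jacobi: "B h s j + B s j h + B j h s = 0" by (simp add: B)
  have T: "(\<Sum>r\<in>UNIV. Rm l k r j p * torsion_comp A c D r h s p)
      = (\<Sum>m\<in>UNIV. \<Gamma> m h s p * Rm l k m j p) + (\<Sum>m\<in>UNIV. \<Gamma> m s h p * Rm l k j m p)" for h s j
    by (simp add: torsion_comp_eq[OF p] curv_comp_antisym[OF p, of l k j] right_diff_distrib
        sum_subtractf sum_negf mult.commute)
  show ?thesis
    using jacobi unfolding T cov_curv_def B_def by (simp add: algebra_simps)
qed

end

section \<open>The metric in the chart\<close>

lemma matrix_inv_inverse:
  assumes "invertible M"
  shows "M ** matrix_inv M = mat 1" "matrix_inv M ** M = mat 1"
  using someI_ex[of "\<lambda>M'. M ** M' = mat 1 \<and> M' ** M = mat 1"] assms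
  unfolding matrix_inv_def invertible_def by auto

locale chart_metric = smooth_chart A c
  for A :: "('m::{t2_space,second_countable_topology}, 'n::finite) chart set"
    and c :: "('m, 'n) chart" +
  fixes g :: "'m \<Rightarrow> 'm tvec \<Rightarrow> 'm tvec \<Rightarrow> real"
  assumes metric: "pseudo_riemannian_metric A g"
begin

abbreviation "G \<equiv> metric_comp A c g"

abbreviation "Gi \<equiv> metric_inv_comp A c g"

lemma metric_commute: "u \<in> tangent_space A p \<Longrightarrow> v \<in> tangent_space A p \<Longrightarrow> g p u v = g p v u"
  using metric[unfolded pseudo_riemannian_metric_def, THEN conjunct1, rule_format, of u p v] by simp

lemma metric_add:
  "u \<in> tangent_space A p \<Longrightarrow> u' \<in> tangent_space A p \<Longrightarrow> v \<in> tangent_space A p \<Longrightarrow>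
    g p (\<lambda>f. u f + u' f) v = g p u v + g p u' v"
  using metric[unfolded pseudo_riemannian_metric_def, THEN conjunct2, THEN conjunct1, rule_format,
      of u p u' v] by simp

lemma metric_scale:
  "u \<in> tangent_space A p \<Longrightarrow> v \<in> tangent_space A p \<Longrightarrow> g p (\<lambda>f. a * u f) v = a * g p u v"
  using metric[unfolded pseudo_riemannian_metric_def, THEN conjunct2, THEN conjunct2, THEN conjunct1,
      rule_format, of u p v a] by simp

lemma metric_nondegenerate:
  "u \<in> tangent_space A p \<Longrightarrow> (\<And>v. v \<in> tangent_space A p \<Longrightarrow> g p u v = 0) \<Longrightarrow> u = (\<lambda>f. 0)"
  using metric[unfolded pseudo_riemannian_metric_def, THEN conjunct2, THEN conjunct2, THEN conjunct2,
      THEN conjunct1, rule_format, of u p] by simp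

lemma smooth_metric:
  "smooth_vf A U X \<Longrightarrow> smooth_vf A U Y \<Longrightarrow> smooth_fun A U (\<lambda>q. g q (X q) (Y q))"
  using metric[unfolded pseudo_riemannian_metric_def, THEN conjunct2, THEN conjunct2, THEN conjunct2,
      THEN conjunct2, rule_format, of U X Y] by simp

lemma smooth_metric_comp: "smooth_fun A U (G i j)"
  unfolding metric_comp_def[abs_def] by (intro smooth_metric smooth_vf_coord_field)

lemma metric_comp_sym: "p \<in> U \<Longrightarrow> G i j p = G j i p"
  unfolding metric_comp_def by (intro metric_commute coord_field_in_tangent_space)

lemma metric_expansion_left:
  assumes p: "p \<in> U" and u: "u \<in> tangent_space A p" and v: "v \<in> tangent_space A p"
  shows "g p u v = (\<Sum>m\<in>UNIV. vec_comp c u m * g p (pd m p) v)"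
proof -
  let ?a = "vec_comp c u"
  have "(\<lambda>f. \<Sum>m\<in>F. ?a m * pd m p f) \<in> tangent_space A p \<and>
      g p (\<lambda>f. \<Sum>m\<in>F. ?a m * pd m p f) v = (\<Sum>m\<in>F. ?a m * g p (pd m p) v)"
    if "finite F" for F
    using that
  proof (induction F rule: finite_induct)
    case empty
    then show ?case
      using tangent_space_scale[OF p u, of 0] metric_scale[OF u v, of 0] by simp
  next
    case (insert m F)
    then show ?case
      using tangent_space_add[OF p, of "\<lambda>f. ?a m * pd m p f" "\<lambda>f. \<Sum>m\<in>F. ?a m * pd m p f"]
        metric_add[of "\<lambda>f. ?a m * pd m p f" p "\<lambda>f. \<Sum>m\<in>F. ?a m * pd m p f" v]
        tangent_space_scale[OF p coord_field_in_tangent_space[OF p], of "?a m" m]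
        metric_scale[OF coord_field_in_tangent_space[OF p] v, of "?a m" m] v
      by simp
  qed
  from this[OF finite, of UNIV] show ?thesis
    using tangent_expansion[OF p u] by simp
qed

lemma metric_expansion_right:
  assumes p: "p \<in> U" and u: "u \<in> tangent_space A p" and v: "v \<in> tangent_space A p"
  shows "g p v u = (\<Sum>m\<in>UNIV. vec_comp c u m * g p v (pd m p))"
  using metric_expansion_left[OF assms] metric_commute[OF v]
    coord_field_in_tangent_space[OF p] u by simp

lemma metric_diff:
  assumes p: "p \<in> U" and "u \<in> tangent_space A p" "u' \<in> tangent_space A p" "v \<in> tangent_space A p"
  shows "g p (\<lambda>f. u f - u' f) v = g p u v - g p u' v"
    and "g p v (\<lambda>f. u f - u' f) = g p v u - g p v u'"
proof -
  have n: "(\<lambda>f. - u' f) \<in> tangent_space A p"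
    using tangent_space_scale[OF p assms(3), of "-1"] by simp
  then have d: "(\<lambda>f. u f - u' f) \<in> tangent_space A p"
    using tangent_space_add[OF p assms(2) n] by simp
  show *: "g p (\<lambda>f. u f - u' f) v = g p u v - g p u' v"
    using metric_add[OF assms(2) n assms(4)] metric_scale[OF assms(3,4), of "-1"] by simp
  show "g p v (\<lambda>f. u f - u' f) = g p v u - g p v u'"
    using * metric_commute[OF d assms(4)] metric_commute[OF assms(2,4)]
      metric_commute[OF assms(3,4)] by simp
qed

abbreviation Gm :: "'m \<Rightarrow> real^'n^'n" where
  "Gm p \<equiv> \<chi> k l. G k l p"

text \<open>A vector in the kernel of the matrix of components is the component vector of a tangent
  vector orthogonal to everything.\<close>

lemma metric_invertible:
  assumes p: "p \<in> U"
  shows "invertible (Gm p)"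
  unfolding invertible_left_inverse matrix_left_invertible_ker
proof (intro allI impI)
  fix x :: "real^'n" assume x: "Gm p *v x = 0"
  let ?u = "\<lambda>f. \<Sum>m\<in>UNIV. x $ m * pd m p f"
  have u: "?u \<in> tangent_space A p" by (rule expansion_in_tangent_space[OF p])
  have "g p (pd k p) ?u = 0" for k
  proof -
    have "g p (pd k p) ?u = (\<Sum>m\<in>UNIV. x $ m * G k m p)"
      using metric_expansion_right[OF p u coord_field_in_tangent_space[OF p]]
      by (simp add: vec_comp_expansion[OF p] metric_comp_def)
    also have "\<dots> = (Gm p *v x) $ k"
      by (simp add: matrix_vector_mult_def mult.commute)
    finally show ?thesis by (simp add: x)
  qed
  then have "g p ?u v = 0" if "v \<in> tangent_space A p" for v
    using metric_expansion_left[OF p that u] metric_commute[OF u that] by simp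
  then have "?u = (\<lambda>f. 0)" by (rule metric_nondegenerate[OF u])
  then have "vec_comp c ?u m = 0" for m by (simp add: vec_comp_def)
  then show "x = 0" by (simp add: vec_comp_expansion[OF p] vec_eq_iff)
qed

lemma metric_inv_right: "p \<in> U \<Longrightarrow> (\<Sum>k\<in>UNIV. G i k p * Gi k j p) = (if i = j then 1 else 0)"
  using matrix_inv_inverse(1)[OF metric_invertible]
  by (simp add: metric_inv_comp_def vec_eq_iff matrix_matrix_mult_def mat_def)

lemma metric_inv_left: "p \<in> U \<Longrightarrow> (\<Sum>k\<in>UNIV. Gi i k p * G k j p) = (if i = j then 1 else 0)"
  using matrix_inv_inverse(2)[OF metric_invertible]
  by (simp add: metric_inv_comp_def vec_eq_iff matrix_matrix_mult_def mat_def)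

lemma metric_inv_sym:
  assumes p: "p \<in> U"
  shows "Gi i j p = Gi j i p"
proof -
  let ?M = "Gm p" and ?N = "matrix_inv (Gm p)"
  have sym: "transpose ?M = ?M"
    using metric_comp_sym[OF p] by (simp add: transpose_def vec_eq_iff)
  have "transpose ?N = transpose ?N ** (?M ** ?N)"
    by (simp add: matrix_inv_inverse[OF metric_invertible[OF p]])
  also have "\<dots> = transpose (?M ** ?N) ** ?N"
    by (simp only: matrix_transpose_mul sym matrix_mul_assoc)
  also have "\<dots> = ?N"
    by (simp add: matrix_inv_inverse[OF metric_invertible[OF p]] transpose_mat)
  finally have "transpose ?N $ j $ i = ?N $ j $ i" by simp
  then show ?thesis by (simp add: transpose_def metric_inv_comp_def)
qed

text \<open>Cramer's rule writes the inverse metric as a quotient of polynomials in the metric, which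
  shows that it is smooth.\<close>

lemma smooth_metric_inv_comp: "smooth_fun A U (Gi i j)"
proof -
  let ?C = "\<lambda>p. \<chi> a b. if b = i then axis j 1 $ a else G a b p"
  have det: "smooth_fun A U (\<lambda>p. det (\<chi> a b. F a b p))" if "\<And>a b. smooth_fun A U (F a b)"
    for F :: "'n \<Rightarrow> 'n \<Rightarrow> 'm \<Rightarrow> real"
    unfolding det_def by (auto intro!: smooth_fun_sum smooth_fun_mult smooth_fun_prod open_U
        smooth_fun_const that)
  have "smooth_fun A U (\<lambda>p. if b = i then axis j 1 $ a else G a b p)" for a b
    by (cases "b = i") (simp_all add: smooth_metric_comp smooth_fun_const open_U)
  then have C: "smooth_fun A U (\<lambda>p. det (?C p))"
    by (rule det)
  have nz: "det (Gm p) \<noteq> 0" if "p \<in> U" for p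
    using metric_invertible[OF that] by (simp add: invertible_det_nz)
  have eq: "det (?C p) * inverse (det (Gm p)) = Gi i j p" if p: "p \<in> U" for p
  proof -
    have "Gm p *v (matrix_inv (Gm p) *v axis j 1) = axis j 1"
      by (simp add: matrix_vector_mul_assoc matrix_inv_inverse[OF metric_invertible[OF p]])
    then have "(matrix_inv (Gm p) *v axis j 1) $ i = det (?C p) / det (Gm p)"
      unfolding cramer[OF nz[OF p]] by (simp cong: if_cong)
    then show ?thesis
      by (simp add: metric_inv_comp_def matrix_vector_mult_basis column_def divide_inverse)
  qed
  show ?thesis
    by (rule smooth_fun_cong[OF order_refl eq])
      (auto intro!: smooth_fun_mult C smooth_fun_inverse[OF order_refl] det smooth_metric_comp nz)
qed

end

lemma sum_first_to_last:
  "(\<Sum>l\<in>A. \<Sum>s\<in>B. \<Sum>m\<in>C. \<Sum>k\<in>E. F l s m k) = (\<Sum>m\<in>C. \<Sum>s\<in>B. \<Sum>k\<in>E. \<Sum>l\<in>A. F l s m k)"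
proof -
  have "(\<Sum>l\<in>A. \<Sum>s\<in>B. \<Sum>m\<in>C. \<Sum>k\<in>E. F l s m k) = (\<Sum>s\<in>B. \<Sum>l\<in>A. \<Sum>m\<in>C. \<Sum>k\<in>E. F l s m k)"
    by (rule sum.swap)
  also have "\<dots> = (\<Sum>s\<in>B. \<Sum>m\<in>C. \<Sum>l\<in>A. \<Sum>k\<in>E. F l s m k)"
    by (rule sum.cong[OF refl], rule sum.swap)
  also have "\<dots> = (\<Sum>s\<in>B. \<Sum>m\<in>C. \<Sum>k\<in>E. \<Sum>l\<in>A. F l s m k)"
    by (rule sum.cong[OF refl], rule sum.cong[OF refl], rule sum.swap)
  also have "\<dots> = (\<Sum>m\<in>C. \<Sum>s\<in>B. \<Sum>k\<in>E. \<Sum>l\<in>A. F l s m k)"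
    by (rule sum.swap)
  finally show ?thesis .
qed

subsection \<open>Dual connections have opposite curvature\<close>

locale metric_connection = chart_metric A c g + chart_connection A c D
  for A :: "('m::{t2_space,second_countable_topology}, 'n::finite) chart set"
    and c :: "('m, 'n) chart" and g D

text \<open>Duality is required along coordinate fields only. In this form it is visibly symmetric in
  \<open>D\<close> and \<open>D'\<close> up to the symmetry of \<open>g\<close>, and the locale will be used for both orders of
  the two connections.\<close>

locale dual_pair = metric_connection A c g D + dual: chart_connection A c D'
  for A :: "('m::{t2_space,second_countable_topology}, 'n::finite) chart set"
    and c :: "('m, 'n) chart" and g D D' +
  assumes dual: "\<And>k Y Z p. smooth_vf A (fst c) Y \<Longrightarrow> smooth_vf A (fst c) Z \<Longrightarrow> p \<in> fst c \<Longrightarrow>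
    coord_field A c k p (\<lambda>q. g q (Y q) (Z q))
      = g p (D (coord_field A c k) Y p) (Z p) + g p (Y p) (D' (coord_field A c k) Z p)"
begin

text \<open>Differentiate $g(Y,Z)$ along two coordinate fields in both orders. The results agree because
  coordinate derivatives commute, and the terms in which \<open>Y\<close> and \<open>Z\<close> are each differentiated
  once cancel in the difference.\<close>

lemma curvature_dual:
  assumes Y: "smooth_vf A U Y" and Z: "smooth_vf A U Z" and p: "p \<in> U"
  shows "g p (curv_op s j Y p) (Z p) + g p (Y p) (dual.curv_op s j Z p) = 0"
proof -
  note s1 = conn_smooth[OF smooth_vf_coord_field] and s2 = dual.conn_smooth[OF smooth_vf_coord_field]
  have second: "pd k p (\<lambda>q. pd l q (\<lambda>q. g q (Y q) (Z q)))
     = g p (D (pd k) (D (pd l) Y) p) (Z p) + g p (D (pd l) Y p) (D' (pd k) Z p)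
     + (g p (D (pd k) Y p) (D' (pd l) Z p) + g p (Y p) (D' (pd k) (D' (pd l) Z) p))" for k l
  proof -
    have "pd k p (\<lambda>q. pd l q (\<lambda>q. g q (Y q) (Z q)))
      = pd k p (\<lambda>q. g q (D (pd l) Y q) (Z q) + g q (Y q) (D' (pd l) Z q))"
      by (rule coord_field_cong[OF open_U p order_refl]) (rule dual[OF Y Z])
    also have "\<dots> = pd k p (\<lambda>q. g q (D (pd l) Y q) (Z q)) + pd k p (\<lambda>q. g q (Y q) (D' (pd l) Z q))"
      by (intro coord_field_add[OF p order_refl] smooth_metric s1 s2 Y Z)
    finally show ?thesis
      by (simp add: dual[OF s1[OF Y] Z p] dual[OF Y s2[OF Z] p])
  qed
  have c: "pd s p (\<lambda>q. pd j q (\<lambda>q. g q (Y q) (Z q))) = pd j p (\<lambda>q. pd s q (\<lambda>q. g q (Y q) (Z q)))"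
    by (rule coord_field_commute[OF p order_refl smooth_metric[OF Y Z]])
  note t = smooth_vf_tangent[OF _ p]
  show ?thesis
    using c unfolding second curv_op_def dual.curv_op_def vf_diff_def
    by (simp add: metric_diff[OF p] t s1 s2 Y Z)
qed

lemma curv_comp_dual:
  assumes p: "p \<in> U"
  shows "(\<Sum>k\<in>UNIV. Rm l k s j p * G k m p) + (\<Sum>k\<in>UNIV. dual.Rm m k s j p * G l k p) = 0"
proof -
  note v = smooth_vf_coord_field
  note t = smooth_vf_tangent[OF _ p]
  have "g p (curv_op s j (pd l) p) (pd m p) = (\<Sum>k\<in>UNIV. Rm l k s j p * G k m p)"
    using metric_expansion_left[OF p t t, OF smooth_curv_op[OF v] v]
    by (simp add: curv_comp_eq[OF p] metric_comp_def)
  moreover have "g p (pd l p) (dual.curv_op s j (pd m) p) = (\<Sum>k\<in>UNIV. dual.Rm m k s j p * G l k p)"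
    using metric_expansion_right[OF p t t, OF dual.smooth_curv_op[OF v] v]
    by (simp add: dual.curv_comp_eq[OF p] metric_comp_def)
  ultimately show ?thesis using curvature_dual[OF v[of l] v[of m] p, of s j] by simp
qed

text \<open>Duality moves the traced index \<open>l\<close> to the upper position of the dual curvature, where the
  inverse metric meets the metric and produces the trace that defines the dual Ricci tensor. This is
  how the Ricci tensor of the dual connection enters the divergence of the Einstein tensor.\<close>

lemma contracted_curv_comp_dual:
  assumes p: "p \<in> U"
  shows "(\<Sum>l\<in>UNIV. \<Sum>s\<in>UNIV. Gi l s p * Rm l h s j p) = - (\<Sum>m\<in>UNIV. Gi h m p * dual.Ric m j p)"
proof -
  have R: "Rm l h s j p = - (\<Sum>m\<in>UNIV. \<Sum>k\<in>UNIV. Gi h m p * (dual.Rm m k s j p * G l k p))" for l s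
  proof -
    have "Rm l h s j p = (\<Sum>k\<in>UNIV. Rm l k s j p * (\<Sum>m\<in>UNIV. G k m p * Gi m h p))"
      by (simp add: metric_inv_right[OF p] if_distrib cong: if_cong)
    also have "\<dots> = (\<Sum>m\<in>UNIV. Gi h m p * (\<Sum>k\<in>UNIV. Rm l k s j p * G k m p))"
      unfolding sum_distrib_left metric_inv_sym[OF p, of h]
      by (subst sum.swap) (simp add: mult_ac)
    also have "\<dots> = - (\<Sum>m\<in>UNIV. Gi h m p * (\<Sum>k\<in>UNIV. dual.Rm m k s j p * G l k p))"
    proof -
      have "(\<Sum>k\<in>UNIV. Rm l k s j p * G k m p) = - (\<Sum>k\<in>UNIV. dual.Rm m k s j p * G l k p)" for m
        using curv_comp_dual[OF p, of l s j m] by linarith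
      then show ?thesis by (simp only: sum_negf mult_minus_right)
    qed
    finally show ?thesis by (simp add: sum_distrib_left)
  qed
  have "(\<Sum>l\<in>UNIV. \<Sum>s\<in>UNIV. Gi l s p * Rm l h s j p)
    = - (\<Sum>l\<in>UNIV. \<Sum>s\<in>UNIV. \<Sum>m\<in>UNIV. \<Sum>k\<in>UNIV. Gi h m p * (dual.Rm m k s j p * (Gi s l p * G l k p)))"
  proof -
    have "Gi l s p * Rm l h s j p
        = - (\<Sum>m\<in>UNIV. \<Sum>k\<in>UNIV. Gi h m p * (dual.Rm m k s j p * (Gi s l p * G l k p)))" for l s
      by (subst metric_inv_sym[OF p, of l s]) (simp add: R sum_distrib_left mult_ac)
    then show ?thesis by (simp only: sum_negf)
  qed
  also have "\<dots> = - (\<Sum>m\<in>UNIV. \<Sum>s\<in>UNIV. \<Sum>k\<in>UNIV. \<Sum>l\<in>UNIV. Gi h m p * (dual.Rm m k s j p * (Gi s l p * G l k p)))"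
    by (subst sum_first_to_last) (rule refl)
  also have "\<dots> = - (\<Sum>m\<in>UNIV. \<Sum>s\<in>UNIV. \<Sum>k\<in>UNIV. Gi h m p * (dual.Rm m k s j p * (\<Sum>l\<in>UNIV. Gi s l p * G l k p)))"
    by (simp add: sum_distrib_left)
  also have "\<dots> = - (\<Sum>m\<in>UNIV. \<Sum>s\<in>UNIV. Gi h m p * dual.Rm m s s j p)"
    by (simp add: metric_inv_left[OF p] if_distrib cong: if_cong)
  finally show ?thesis by (simp add: ricci_def sum_distrib_left)
qed

end

section \<open>Contractions and the product rule\<close>

context chart_connection
begin

lemma coord_field_minus:
  assumes "p \<in> W" "W \<subseteq> U" "smooth_fun A W f"
  shows "pd k p (\<lambda>q. - f q) = - pd k p f"
  using coord_field_cmult[OF assms, of k "-1"] by simp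

lemma cov_curv_antisym:
  assumes p: "p \<in> U"
  shows "cov_curv h l k j s p = - cov_curv h l k s j p"
proof -
  have "pd h p (Rm l k j s) = pd h p (\<lambda>q. - Rm l k s j q)"
    by (rule coord_field_cong[OF open_U p order_refl]) (rule curv_comp_antisym)
  also have "\<dots> = - pd h p (Rm l k s j)"
    by (rule coord_field_minus[OF p order_refl smooth_curv_comp])
  finally have d: "pd h p (Rm l k j s) = - pd h p (Rm l k s j)" .
  have a: "Rm l m j s p = - Rm l m s j p" "Rm m k j s p = - Rm m k s j p"
    "Rm l k m s p = - Rm l k s m p" "Rm l k j m p = - Rm l k m j p" for m
    by (rule curv_comp_antisym[OF p])+
  show ?thesis unfolding cov_curv_def d a by (simp add: sum_negf)
qed

text \<open>Covariant differentiation commutes with the trace: the Christoffel terms of the two traced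
  indices cancel.\<close>

lemma contract_cov_curv:
  assumes p: "p \<in> U"
  shows "(\<Sum>h\<in>UNIV. cov_curv k l h h s p) = cov_lower A c D Ric k l s p"
proof -
  have d: "pd k p (Ric l s) = (\<Sum>h\<in>UNIV. pd k p (Rm l h h s))"
    unfolding ricci_def[abs_def] by (intro coord_field_sum[OF p order_refl open_U] smooth_curv_comp)
  have c: "(\<Sum>h\<in>UNIV. \<Sum>m\<in>UNIV. \<Gamma> h k m p * Rm l m h s p)
      = (\<Sum>h\<in>UNIV. \<Sum>m\<in>UNIV. \<Gamma> m k h p * Rm l h m s p)"
    by (rule sum.swap)
  have e: "(\<Sum>h\<in>UNIV. \<Sum>m\<in>UNIV. \<Gamma> m k l p * Rm m h h s p) = (\<Sum>m\<in>UNIV. \<Gamma> m k l p * Ric m s p)"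
    by (subst sum.swap) (simp add: ricci_def sum_distrib_left)
  have f: "(\<Sum>h\<in>UNIV. \<Sum>m\<in>UNIV. \<Gamma> m k s p * Rm l h h m p) = (\<Sum>m\<in>UNIV. \<Gamma> m k s p * Ric l m p)"
    by (subst sum.swap) (simp add: ricci_def sum_distrib_left)
  show ?thesis
    unfolding cov_curv_def cov_lower_def by (simp add: d c e f sum.distrib sum_subtractf)
qed

text \<open>Tracing the upper index of the curvature against its first form index in the second Bianchi
  identity leaves two covariant derivatives of the Ricci tensor and one divergence.\<close>

lemma contracted_bianchi:
  assumes p: "p \<in> U"
  shows "cov_lower A c D Ric j l s p = cov_lower A c D Ric s l j p
    - (\<Sum>h\<in>UNIV. cov_curv h l h s j p)
    - ((\<Sum>h\<in>UNIV. \<Sum>r\<in>UNIV. Rm l h r j p * torsion_comp A c D r h s p)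
      - (\<Sum>r\<in>UNIV. Ric l r p * torsion_comp A c D r s j p)
      + (\<Sum>h\<in>UNIV. \<Sum>r\<in>UNIV. Rm l h r s p * torsion_comp A c D r j h p))"
proof -
  have "(\<Sum>h\<in>UNIV. cov_curv h l h s j p + cov_curv s l h j h p + cov_curv j l h h s p
    + (\<Sum>r\<in>UNIV. Rm l h r j p * torsion_comp A c D r h s p)
    + (\<Sum>r\<in>UNIV. Rm l h r h p * torsion_comp A c D r s j p)
    + (\<Sum>r\<in>UNIV. Rm l h r s p * torsion_comp A c D r j h p)) = 0"
    by (rule sum.neutral) (simp add: second_bianchi[OF p])
  moreover have "(\<Sum>h\<in>UNIV. cov_curv s l h j h p) = - cov_lower A c D Ric s l j p"
    by (simp add: cov_curv_antisym[OF p, of s l _ j] sum_negf contract_cov_curv[OF p])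
  moreover have "(\<Sum>h\<in>UNIV. \<Sum>r\<in>UNIV. Rm l h r h p * torsion_comp A c D r s j p)
      = - (\<Sum>r\<in>UNIV. Ric l r p * torsion_comp A c D r s j p)"
    by (subst sum.swap)
      (simp add: curv_comp_antisym[OF p, of l h r h for h r] ricci_def sum_negf sum_distrib_right)
  ultimately show ?thesis
    by (simp add: sum.distrib contract_cov_curv[OF p])
qed

text \<open>The covariant derivative $\nabla_k Q^h_{\ j}$ of a mixed tensor. It will be applied to
  $Q^h_{\ j} = g^{ls} R_{l\ sj}^{\ h}$.\<close>

definition cov_mixed :: "('n \<Rightarrow> 'n \<Rightarrow> 'm \<Rightarrow> real) \<Rightarrow> 'n \<Rightarrow> 'n \<Rightarrow> 'n \<Rightarrow> 'm \<Rightarrow> real" where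
  "cov_mixed Q k h j p = pd k p (Q h j)
     + (\<Sum>m\<in>UNIV. \<Gamma> h k m p * Q m j p) - (\<Sum>m\<in>UNIV. \<Gamma> m k j p * Q h m p)"

lemma cov_mixed_cong:
  assumes "\<And>h j q. q \<in> U \<Longrightarrow> Q h j q = Q' h j q" "p \<in> U"
  shows "cov_mixed Q k h j p = cov_mixed Q' k h j p"
  using assms coord_field_cong[OF open_U \<open>p \<in> U\<close> order_refl, of "Q h j" "Q' h j" k]
  by (simp add: cov_mixed_def)

end

lemma sum_transpose_mult:
  fixes X :: "'a \<Rightarrow> 'a \<Rightarrow> real"
  shows "(\<Sum>l\<in>F. (\<Sum>m\<in>F. X l m * a m) * S l) = (\<Sum>l\<in>F. a l * (\<Sum>m\<in>F. X m l * S m))"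
  unfolding sum_distrib_left sum_distrib_right by (subst sum.swap) (simp add: mult_ac)

lemma sum_pull_inner:
  fixes a :: "'a \<Rightarrow> 'b \<Rightarrow> real"
  shows "(\<Sum>l\<in>F. \<Sum>s\<in>H. a l s * (\<Sum>m\<in>K. x m * T m l s)) = (\<Sum>m\<in>K. x m * (\<Sum>l\<in>F. \<Sum>s\<in>H. a l s * T m l s))"
proof -
  have "(\<Sum>l\<in>F. \<Sum>s\<in>H. a l s * (\<Sum>m\<in>K. x m * T m l s)) = (\<Sum>l\<in>F. \<Sum>s\<in>H. \<Sum>m\<in>K. x m * (a l s * T m l s))"
    by (simp add: sum_distrib_left mult_ac)
  also have "\<dots> = (\<Sum>l\<in>F. \<Sum>m\<in>K. \<Sum>s\<in>H. x m * (a l s * T m l s))"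
    by (rule sum.cong[OF refl], rule sum.swap)
  also have "\<dots> = (\<Sum>m\<in>K. \<Sum>l\<in>F. \<Sum>s\<in>H. x m * (a l s * T m l s))"
    by (rule sum.swap)
  finally show ?thesis by (simp add: sum_distrib_left)
qed

context metric_connection
begin

abbreviation "dGi \<equiv> cov_upper A c D Gi"

text \<open>Moving a Christoffel symbol from the inverse metric to the tensor that it is contracted
  with.\<close>

lemma christoffel_contraction:
  "(\<Sum>l\<in>UNIV. \<Sum>s\<in>UNIV. (\<Sum>m\<in>UNIV. \<Gamma> l k m p * Gi m s p) * S l s)
    = (\<Sum>l\<in>UNIV. \<Sum>s\<in>UNIV. Gi l s p * (\<Sum>m\<in>UNIV. \<Gamma> m k l p * S m s))"
  "(\<Sum>l\<in>UNIV. \<Sum>s\<in>UNIV. (\<Sum>m\<in>UNIV. \<Gamma> s k m p * Gi l m p) * S l s)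
    = (\<Sum>l\<in>UNIV. \<Sum>s\<in>UNIV. Gi l s p * (\<Sum>m\<in>UNIV. \<Gamma> m k s p * S l m))"
proof -
  show "(\<Sum>l\<in>UNIV. \<Sum>s\<in>UNIV. (\<Sum>m\<in>UNIV. \<Gamma> l k m p * Gi m s p) * S l s)
    = (\<Sum>l\<in>UNIV. \<Sum>s\<in>UNIV. Gi l s p * (\<Sum>m\<in>UNIV. \<Gamma> m k l p * S m s))"
    unfolding sum.swap[of "\<lambda>l s. (\<Sum>m\<in>UNIV. \<Gamma> l k m p * Gi m s p) * S l s"]
      sum.swap[of "\<lambda>l s. Gi l s p * (\<Sum>m\<in>UNIV. \<Gamma> m k l p * S m s)"]
    by (rule sum.cong[OF refl], rule sum_transpose_mult)
  show "(\<Sum>l\<in>UNIV. \<Sum>s\<in>UNIV. (\<Sum>m\<in>UNIV. \<Gamma> s k m p * Gi l m p) * S l s)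
    = (\<Sum>l\<in>UNIV. \<Sum>s\<in>UNIV. Gi l s p * (\<Sum>m\<in>UNIV. \<Gamma> m k s p * S l m))"
    by (rule sum.cong[OF refl], rule sum_transpose_mult)
qed

lemma coord_field_trace:
  assumes p: "p \<in> U" and S: "\<And>l s. smooth_fun A U (S l s)"
  shows "pd k p (\<lambda>q. \<Sum>l\<in>UNIV. \<Sum>s\<in>UNIV. Gi l s q * S l s q)
    = (\<Sum>l\<in>UNIV. \<Sum>s\<in>UNIV. Gi l s p * pd k p (S l s) + pd k p (Gi l s) * S l s p)"
  by (simp add: coord_field_sum[OF p order_refl open_U] coord_field_mult[OF p order_refl]
      smooth_metric_inv_comp S smooth_fun_mult smooth_fun_sum open_U)

text \<open>The product rule for the trace of a tensor: the Christoffel terms that complete the two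
  factors to covariant derivatives cancel.\<close>

lemma cov_scalar_trace:
  assumes p: "p \<in> U" and S: "\<And>l s. smooth_fun A U (S l s)"
  shows "pd k p (\<lambda>q. \<Sum>l\<in>UNIV. \<Sum>s\<in>UNIV. Gi l s q * S l s q)
    = (\<Sum>l\<in>UNIV. \<Sum>s\<in>UNIV. dGi k l s p * S l s p)
      + (\<Sum>l\<in>UNIV. \<Sum>s\<in>UNIV. Gi l s p * cov_lower A c D S k l s p)"
  unfolding coord_field_trace[OF assms] cov_upper_def cov_lower_def
  by (simp add: distrib_right right_diff_distrib sum.distrib sum_subtractf
      christoffel_contraction[of k p "\<lambda>l s. S l s p"])

lemma cov_mixed_raise:
  assumes p: "p \<in> U" and S: "\<And>l s. smooth_fun A U (S l s)"
  shows "cov_mixed (\<lambda>h j q. \<Sum>m\<in>UNIV. Gi h m q * S m j q) k h j p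
    = (\<Sum>m\<in>UNIV. dGi k h m p * S m j p) + (\<Sum>m\<in>UNIV. Gi h m p * cov_lower A c D S k m j p)"
proof -
  have d: "pd k p (\<lambda>q. \<Sum>m\<in>UNIV. Gi h m q * S m j q)
      = (\<Sum>m\<in>UNIV. Gi h m p * pd k p (S m j)) + (\<Sum>m\<in>UNIV. pd k p (Gi h m) * S m j p)"
    by (simp add: coord_field_sum[OF p order_refl open_U] coord_field_mult[OF p order_refl]
        smooth_metric_inv_comp S smooth_fun_mult sum.distrib)
  have 1: "(\<Sum>m\<in>UNIV. (\<Sum>r\<in>UNIV. \<Gamma> h k r p * Gi r m p) * S m j p)
      = (\<Sum>r\<in>UNIV. \<Gamma> h k r p * (\<Sum>m\<in>UNIV. Gi r m p * S m j p))"
    unfolding sum_distrib_left sum_distrib_right by (subst sum.swap) (simp add: mult_ac)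
  have 2: "(\<Sum>m\<in>UNIV. (\<Sum>r\<in>UNIV. \<Gamma> m k r p * Gi h r p) * S m j p)
      = (\<Sum>m\<in>UNIV. Gi h m p * (\<Sum>r\<in>UNIV. \<Gamma> r k m p * S r j p))"
    by (rule sum_transpose_mult)
  have 3: "(\<Sum>m\<in>UNIV. Gi h m p * (\<Sum>r\<in>UNIV. \<Gamma> r k j p * S m r p))
      = (\<Sum>r\<in>UNIV. \<Gamma> r k j p * (\<Sum>m\<in>UNIV. Gi h m p * S m r p))"
    unfolding sum_distrib_left by (subst sum.swap) (simp add: mult_ac)
  show ?thesis
    unfolding cov_mixed_def cov_upper_def cov_lower_def d
    by (simp add: distrib_right right_diff_distrib sum.distrib sum_subtractf 1 2 3)
qed

lemma cov_mixed_curv: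
  assumes p: "p \<in> U"
  shows "cov_mixed (\<lambda>h j q. \<Sum>l\<in>UNIV. \<Sum>s\<in>UNIV. Gi l s q * Rm l h s j q) k h j p
    = (\<Sum>l\<in>UNIV. \<Sum>s\<in>UNIV. dGi k l s p * Rm l h s j p)
      + (\<Sum>l\<in>UNIV. \<Sum>s\<in>UNIV. Gi l s p * cov_curv k l h s j p)"
  unfolding cov_mixed_def coord_field_trace[OF p smooth_curv_comp] cov_upper_def cov_curv_def
  by (simp add: distrib_right distrib_left right_diff_distrib sum.distrib sum_subtractf
      christoffel_contraction[of k p "\<lambda>l s. Rm l h s j p"] sum_pull_inner)

subsection \<open>The divergence of the Einstein tensor\<close>

lemma smooth_ricci_scalar: "smooth_fun A U (ricci_scalar A c g D)"
  unfolding ricci_scalar_def[abs_def]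
  by (intro smooth_fun_sum smooth_fun_mult open_U smooth_metric_inv_comp smooth_ricci)

lemma smooth_ricci_sym: "smooth_fun A U (ricci_sym A c D i j)"
  unfolding ricci_sym_def[abs_def] by (intro smooth_fun_cmult smooth_fun_add smooth_ricci)

text \<open>Only the product rule is used, so the divergence may be taken with a connection \<open>E\<close>
  other than the one that defines the curvature.
  The last term arises as $g^{is} g_{ij} \partial_s R = \partial_j R$.\<close>

lemma div_einstein:
  assumes p: "p \<in> U"
  shows "div_lower A c g E (einstein A c g D) j p = div_lower A c g E (ricci_sym A c D) j p
    - 1/2 * div_lower A c g E G j p * ricci_scalar A c g D p - 1/2 * pd j p (ricci_scalar A c g D)"
proof -
  let ?R = "ricci_scalar A c g D"
  have d: "pd k p (einstein A c g D i j)
      = pd k p (ricci_sym A c D i j) - 1/2 * (G i j p * pd k p ?R + pd k p (G i j) * ?R p)" for k i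
  proof -
    have "pd k p (einstein A c g D i j) = pd k p (\<lambda>q. ricci_sym A c D i j q - 1/2 * (G i j q * ?R q))"
      by (simp add: einstein_def[abs_def] mult.assoc)
    also have "\<dots> = pd k p (ricci_sym A c D i j) - pd k p (\<lambda>q. 1/2 * (G i j q * ?R q))"
      by (intro coord_field_diff[OF p order_refl] smooth_ricci_sym smooth_fun_cmult smooth_fun_mult
          smooth_metric_comp smooth_ricci_scalar)
    also have "pd k p (\<lambda>q. 1/2 * (G i j q * ?R q)) = 1/2 * pd k p (\<lambda>q. G i j q * ?R q)"
      by (intro coord_field_cmult[OF p order_refl] smooth_fun_mult smooth_metric_comp smooth_ricci_scalar)
    also have "pd k p (\<lambda>q. G i j q * ?R q) = G i j p * pd k p ?R + pd k p (G i j) * ?R p"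
      by (rule coord_field_mult[OF p order_refl smooth_metric_comp smooth_ricci_scalar])
    finally show ?thesis .
  qed
  have cov: "cov_lower A c E (einstein A c g D) k i j p = cov_lower A c E (ricci_sym A c D) k i j p
      - 1/2 * (cov_lower A c E G k i j p * ?R p) - 1/2 * (G i j p * pd k p ?R)" for k i
    unfolding cov_lower_def d
    by (simp add: einstein_def algebra_simps sum.distrib sum_subtractf sum_distrib_left sum_distrib_right
        flip: sum_divide_distrib)
  have "(\<Sum>i\<in>UNIV. \<Sum>s\<in>UNIV. Gi i s p * (G i j p * pd s p ?R))
      = (\<Sum>s\<in>UNIV. (\<Sum>i\<in>UNIV. Gi s i p * G i j p) * pd s p ?R)"
    unfolding sum_distrib_right by (subst sum.swap) (simp add: metric_inv_sym[OF p] mult_ac)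
  also have "\<dots> = pd j p ?R"
    by (simp add: metric_inv_left[OF p] if_distrib[of "\<lambda>x. x * _"] cong: if_cong)
  finally have tr: "(\<Sum>i\<in>UNIV. \<Sum>s\<in>UNIV. Gi i s p * (G i j p * pd s p ?R)) = pd j p ?R" .
  have "div_lower A c g E (einstein A c g D) j p = div_lower A c g E (ricci_sym A c D) j p
      - 1/2 * (div_lower A c g E G j p * ?R p)
      - 1/2 * (\<Sum>i\<in>UNIV. \<Sum>s\<in>UNIV. Gi i s p * (G i j p * pd s p ?R))"
    unfolding div_lower_def cov sum_distrib_left sum_distrib_right
    by (simp add: right_diff_distrib sum_subtractf mult_ac)
  then show ?thesis by (simp add: tr)
qed

lemma div_add_cmult:
  assumes p: "p \<in> U" and S: "\<And>i j. smooth_fun A U (S i j)" "\<And>i j. smooth_fun A U (S' i j)"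
  shows "div_lower A c g E (\<lambda>i j q. a * S i j q + b * S' i j q) j p
    = a * div_lower A c g E S j p + b * div_lower A c g E S' j p"
proof -
  have d: "pd k p (\<lambda>q. a * S i j q + b * S' i j q) = a * pd k p (S i j) + b * pd k p (S' i j)" for k i j
    by (simp add: coord_field_add[OF p order_refl] coord_field_cmult[OF p order_refl] S smooth_fun_cmult)
  have "cov_lower A c E (\<lambda>i j q. a * S i j q + b * S' i j q) k i j p
      = a * cov_lower A c E S k i j p + b * cov_lower A c E S' k i j p" for k i
    unfolding cov_lower_def d
    by (simp add: algebra_simps sum.distrib sum_distrib_left)
  then show ?thesis
    unfolding div_lower_def sum_distrib_left
    by (simp add: distrib_left sum.distrib mult_ac)
qed

end

section \<open>The derivative of the scalar curvature\<close>

context dual_pair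
begin

text \<open>Both sides come from the divergence of $Q^h_{\ j} = g^{ls} R_{l\ sj}^{\ h} = - g^{hm} R^*_{mj}$,
  computed with the product rule from either expression. The covariant derivatives of the
  inverse metric remain because neither connection need be metric.\<close>

lemma divergence_contracted_curv:
  assumes p: "p \<in> U"
  shows "(\<Sum>l\<in>UNIV. \<Sum>s\<in>UNIV. Gi l s p * (\<Sum>h\<in>UNIV. cov_curv h l h s j p))
    = - div_lower A c g D dual.Ric j p
      - (\<Sum>h\<in>UNIV. \<Sum>l\<in>UNIV. \<Sum>s\<in>UNIV. dGi h l s p * Rm l h s j p)
      - (\<Sum>h\<in>UNIV. \<Sum>s\<in>UNIV. dGi h h s p * dual.Ric s j p)"
proof -
  let ?Q = "\<lambda>h j q. \<Sum>l\<in>UNIV. \<Sum>s\<in>UNIV. Gi l s q * Rm l h s j q"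
  let ?Q' = "\<lambda>h j q. \<Sum>m\<in>UNIV. Gi h m q * - dual.Ric m j q"
  have "cov_mixed ?Q h h j p = cov_mixed ?Q' h h j p" for h
    by (rule cov_mixed_cong[OF _ p]) (simp add: contracted_curv_comp_dual sum_negf)
  moreover have "cov_mixed ?Q' h h j p = - (\<Sum>m\<in>UNIV. dGi h h m p * dual.Ric m j p)
      - (\<Sum>m\<in>UNIV. Gi h m p * cov_lower A c D dual.Ric h m j p)" for h
  proof -
    have "cov_lower A c D (\<lambda>i j q. - dual.Ric i j q) h m j p = - cov_lower A c D dual.Ric h m j p" for m
      by (simp add: cov_lower_def coord_field_minus[OF p order_refl dual.smooth_ricci] sum_negf)
    moreover have "cov_mixed ?Q' h h j p = (\<Sum>m\<in>UNIV. dGi h h m p * - dual.Ric m j p)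
        + (\<Sum>m\<in>UNIV. Gi h m p * cov_lower A c D (\<lambda>i j q. - dual.Ric i j q) h m j p)"
      by (rule cov_mixed_raise[OF p]) (rule smooth_fun_minus[OF dual.smooth_ricci])
    ultimately show ?thesis by (simp add: sum_negf)
  qed
  ultimately have "(\<Sum>h\<in>UNIV. (\<Sum>l\<in>UNIV. \<Sum>s\<in>UNIV. dGi h l s p * Rm l h s j p)
        + (\<Sum>l\<in>UNIV. \<Sum>s\<in>UNIV. Gi l s p * cov_curv h l h s j p))
      = (\<Sum>h\<in>UNIV. - (\<Sum>m\<in>UNIV. dGi h h m p * dual.Ric m j p)
      - (\<Sum>m\<in>UNIV. Gi h m p * cov_lower A c D dual.Ric h m j p))"
    by (simp add: cov_mixed_curv[OF p])
  moreover have "(\<Sum>h\<in>UNIV. \<Sum>m\<in>UNIV. Gi h m p * cov_lower A c D dual.Ric h m j p)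
      = div_lower A c g D dual.Ric j p"
    unfolding div_lower_def by (subst sum.swap) (simp add: metric_inv_sym[OF p])
  moreover have "(\<Sum>l\<in>UNIV. \<Sum>s\<in>UNIV. Gi l s p * (\<Sum>h\<in>UNIV. cov_curv h l h s j p))
      = (\<Sum>h\<in>UNIV. \<Sum>l\<in>UNIV. \<Sum>s\<in>UNIV. Gi l s p * cov_curv h l h s j p)"
    using sum_pull_inner[where x = "\<lambda>_. 1"] by simp
  ultimately show ?thesis by (simp add: sum.distrib sum_subtractf sum_negf)
qed

text \<open>Trace the contracted Bianchi identity with the inverse metric. The divergence of the
  curvature that it contains becomes the divergence of the dual Ricci tensor.\<close>

lemma cov_scalar_ricci_scalar:
  assumes p: "p \<in> U"
  shows "pd j p (ricci_scalar A c g D) = div_lower A c g D Ric j p + div_lower A c g D dual.Ric j p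
    + (\<Sum>h\<in>UNIV. \<Sum>l\<in>UNIV. \<Sum>s\<in>UNIV. dGi h l s p * Rm l h s j p)
    + (\<Sum>l\<in>UNIV. \<Sum>s\<in>UNIV. dGi j l s p * Ric l s p)
    + (\<Sum>h\<in>UNIV. \<Sum>s\<in>UNIV. dGi h h s p * dual.Ric s j p)
    - ((\<Sum>l\<in>UNIV. \<Sum>s\<in>UNIV. \<Sum>h\<in>UNIV. \<Sum>r\<in>UNIV.
          Gi l s p * Rm l h r j p * torsion_comp A c D r h s p)
      - (\<Sum>l\<in>UNIV. \<Sum>s\<in>UNIV. \<Sum>r\<in>UNIV. Gi l s p * Ric l r p * torsion_comp A c D r s j p)
      + (\<Sum>l\<in>UNIV. \<Sum>s\<in>UNIV. \<Sum>h\<in>UNIV. \<Sum>r\<in>UNIV.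
          Gi l s p * Rm l h r s p * torsion_comp A c D r j h p))"
proof -
  have "(\<Sum>l\<in>UNIV. \<Sum>s\<in>UNIV. Gi l s p * cov_lower A c D Ric j l s p)
    = div_lower A c g D Ric j p
      - (\<Sum>l\<in>UNIV. \<Sum>s\<in>UNIV. Gi l s p * (\<Sum>h\<in>UNIV. cov_curv h l h s j p))
      - ((\<Sum>l\<in>UNIV. \<Sum>s\<in>UNIV. \<Sum>h\<in>UNIV. \<Sum>r\<in>UNIV.
          Gi l s p * Rm l h r j p * torsion_comp A c D r h s p)
      - (\<Sum>l\<in>UNIV. \<Sum>s\<in>UNIV. \<Sum>r\<in>UNIV. Gi l s p * Ric l r p * torsion_comp A c D r s j p)
      + (\<Sum>l\<in>UNIV. \<Sum>s\<in>UNIV. \<Sum>h\<in>UNIV. \<Sum>r\<in>UNIV.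
          Gi l s p * Rm l h r s p * torsion_comp A c D r j h p))"
    unfolding contracted_bianchi[OF p, of j] div_lower_def
    by (simp add: right_diff_distrib distrib_left sum.distrib sum_subtractf sum_distrib_left mult.assoc)
  then show ?thesis
    unfolding divergence_contracted_curv[OF p] ricci_scalar_def[abs_def] cov_scalar_trace[OF p smooth_ricci]
    by simp
qed

text \<open>The divergence of the Ricci tensor in the derivative of the scalar curvature cancels one half of
  the symmetrized one. What remains of the symmetrization is the transposed Ricci tensor, which
  is then compared with the dual Ricci tensor.\<close>

lemma div_einstein_dual_pair:
  assumes p: "p \<in> U"
  shows "div_lower A c g D (einstein A c g D) j p =
      - 1/2 * (div_lower A c g D (\<lambda>i j q. dual.Ric i j q - Ric j i q) j p
        + div_lower A c g D G j p * ricci_scalar A c g D p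
        + (\<Sum>h\<in>UNIV. \<Sum>l\<in>UNIV. \<Sum>s\<in>UNIV. dGi h l s p * Rm l h s j p)
        + (\<Sum>l\<in>UNIV. \<Sum>s\<in>UNIV. dGi j l s p * Ric l s p)
        + (\<Sum>h\<in>UNIV. \<Sum>s\<in>UNIV. dGi h h s p * dual.Ric s j p))
      + 1/2 * ((\<Sum>l\<in>UNIV. \<Sum>s\<in>UNIV. \<Sum>h\<in>UNIV. \<Sum>r\<in>UNIV.
          Gi l s p * Rm l h r j p * torsion_comp A c D r h s p)
      - (\<Sum>l\<in>UNIV. \<Sum>s\<in>UNIV. \<Sum>r\<in>UNIV. Gi l s p * Ric l r p * torsion_comp A c D r s j p)
      + (\<Sum>l\<in>UNIV. \<Sum>s\<in>UNIV. \<Sum>h\<in>UNIV. \<Sum>r\<in>UNIV.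
          Gi l s p * Rm l h r s p * torsion_comp A c D r j h p))"
proof -
  have "div_lower A c g D (ricci_sym A c D) j p
      = 1/2 * div_lower A c g D Ric j p + 1/2 * div_lower A c g D (\<lambda>i j. Ric j i) j p"
    using div_add_cmult[OF p, of Ric "\<lambda>i j. Ric j i" D "1/2" "1/2" j] smooth_ricci
    by (simp add: ricci_sym_def[abs_def] distrib_left)
  moreover have "div_lower A c g D (\<lambda>i j q. dual.Ric i j q - Ric j i q) j p
      = div_lower A c g D dual.Ric j p - div_lower A c g D (\<lambda>i j. Ric j i) j p"
    using div_add_cmult[OF p, of dual.Ric "\<lambda>i j. Ric j i" D 1 "-1" j] smooth_ricci dual.smooth_ricci
    by simp
  ultimately show ?thesis
    unfolding div_einstein[OF p] cov_scalar_ricci_scalar[OF p] by (simp add: algebra_simps)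
qed

end

lemma torsion_free_torsion_comp:
  assumes "smooth_chart A c" "torsion_free A D" "p \<in> fst c"
  shows "torsion_comp A c D i k l p = 0"
proof -
  interpret smooth_chart A c by (rule assms(1))
  have "torsion A D (pd k) (pd l) p = (\<lambda>f. 0)"
    using assms(2,3) smooth_vf_coord_field unfolding torsion_free_def by blast
  then show ?thesis by (simp add: torsion_comp_def vec_comp_def)
qed

theorem theorem5p12:
  fixes A :: "('m::{t2_space,second_countable_topology}, 'n::finite) chart set"
    and g :: "'m \<Rightarrow> 'm tvec \<Rightarrow> 'm tvec \<Rightarrow> real"
    and D Ds :: "'m vfield \<Rightarrow> 'm vfield \<Rightarrow> 'm vfield"
    and c :: "('m, 'n) chart" and p :: 'm and j :: 'n
  assumes "quasi_statistical_manifold A g D"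
    and "dual_connection A g D Ds"
    and "c \<in> A" and "p \<in> fst c"
  shows "div_lower A c g D (einstein A c g D) j p =
      - 1/2 * (div_lower A c g D (\<lambda>i j q. ricci A c Ds i j q - ricci A c D j i q) j p
        + div_lower A c g D (metric_comp A c g) j p * ricci_scalar A c g D p
        + (\<Sum>h\<in>UNIV. \<Sum>l\<in>UNIV. \<Sum>s\<in>UNIV.
             cov_upper A c D (metric_inv_comp A c g) h l s p * curv_comp A c D l h s j p)
        + (\<Sum>l\<in>UNIV. \<Sum>s\<in>UNIV.
             cov_upper A c D (metric_inv_comp A c g) j l s p * ricci A c D l s p)
        + (\<Sum>h\<in>UNIV. \<Sum>s\<in>UNIV.
             cov_upper A c D (metric_inv_comp A c g) h h s p * ricci A c Ds s j p))
    \<and> div_lower A c g Ds (einstein A c g Ds) j p =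
      - 1/2 * (div_lower A c g Ds (\<lambda>i j q. ricci A c D i j q - ricci A c Ds j i q) j p
        + div_lower A c g Ds (metric_comp A c g) j p * ricci_scalar A c g Ds p
        + (\<Sum>h\<in>UNIV. \<Sum>l\<in>UNIV. \<Sum>s\<in>UNIV.
             cov_upper A c Ds (metric_inv_comp A c g) h l s p * curv_comp A c Ds l h s j p)
        + (\<Sum>l\<in>UNIV. \<Sum>s\<in>UNIV.
             cov_upper A c Ds (metric_inv_comp A c g) j l s p * ricci A c Ds l s p)
        + (\<Sum>h\<in>UNIV. \<Sum>s\<in>UNIV.
             cov_upper A c Ds (metric_inv_comp A c g) h h s p * ricci A c D s j p))
      + 1/2 * ((\<Sum>l\<in>UNIV. \<Sum>s\<in>UNIV. \<Sum>h\<in>UNIV. \<Sum>r\<in>UNIV.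
             metric_inv_comp A c g l s p * curv_comp A c Ds l h r j p * torsion_comp A c Ds r h s p)
        - (\<Sum>l\<in>UNIV. \<Sum>s\<in>UNIV. \<Sum>r\<in>UNIV.
             metric_inv_comp A c g l s p * ricci A c Ds l r p * torsion_comp A c Ds r s j p)
        + (\<Sum>l\<in>UNIV. \<Sum>s\<in>UNIV. \<Sum>h\<in>UNIV. \<Sum>r\<in>UNIV.
             metric_inv_comp A c g l s p * curv_comp A c Ds l h r s p * torsion_comp A c Ds r j h p))
    \<and> div_lower A c g Ds (einstein A c g D) j p =
      div_lower A c g Ds (ricci_sym A c D) j p
        - 1/2 * div_lower A c g Ds (metric_comp A c g) j p * ricci_scalar A c g D p
        - 1/2 * cov_scalar A c j (ricci_scalar A c g D) p
    \<and> div_lower A c g D (einstein A c g Ds) j p =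
      div_lower A c g D (ricci_sym A c Ds) j p
        - 1/2 * div_lower A c g D (metric_comp A c g) j p * ricci_scalar A c g Ds p
        - 1/2 * cov_scalar A c j (ricci_scalar A c g Ds) p"
proof -
  have D: "smooth_structure A" "pseudo_riemannian_metric A g" "affine_connection A D" "torsion_free A D"
    using assms(1) by (simp_all add: quasi_statistical_manifold_def)
  have Ds: "affine_connection A Ds"
    using assms(2) by (simp add: dual_connection_def)
  interpret metric_connection A c g D
    by unfold_locales (use D assms(3) in auto)
  have dual: "pd k q (\<lambda>q. g q (Y q) (Z q)) = g q (D (pd k) Y q) (Z q) + g q (Y q) (Ds (pd k) Z q)"
    if "smooth_vf A U Y" "smooth_vf A U Z" "q \<in> U" for k Y Z q
    using assms(2)[unfolded dual_connection_def, THEN conjunct2, rule_format, of U "pd k" Y Z q]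
      that smooth_vf_coord_field by blast
  interpret P: dual_pair A c g D Ds
    by unfold_locales (use Ds dual in auto)
  \<comment> \<open>by symmetry of the metric, \<open>D\<close> is in turn the dual connection of \<open>Ds\<close>\<close>
  have dual': "pd k q (\<lambda>q. g q (Y q) (Z q)) = g q (Ds (pd k) Y q) (Z q) + g q (Y q) (D (pd k) Z q)"
    if Y: "smooth_vf A U Y" and Z: "smooth_vf A U Z" and q: "q \<in> U" for k Y Z q
  proof -
    note t = smooth_vf_tangent[OF _ q]
    note t' = t[OF conn_smooth[OF smooth_vf_coord_field]] t[OF P.dual.conn_smooth[OF smooth_vf_coord_field]]
    have "pd k q (\<lambda>q. g q (Y q) (Z q)) = pd k q (\<lambda>q. g q (Z q) (Y q))"
      by (rule coord_field_cong[OF open_U q order_refl])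
        (rule metric_commute[OF smooth_vf_tangent[OF Y] smooth_vf_tangent[OF Z]])
    then show ?thesis
      using dual[OF Z Y q, of k] metric_commute[OF t'(1)[OF Z] t[OF Y], of k]
        metric_commute[OF t[OF Z] t'(2)[OF Y], of k] by simp
  qed
  interpret Ps: dual_pair A c g Ds D
    by unfold_locales (use dual' in auto)
  note p = assms(4)
  have tf: "torsion_comp A c D i k l p = 0" for i k l
    by (rule torsion_free_torsion_comp[OF smooth_chart_axioms D(4) p])
  show ?thesis
    unfolding P.div_einstein_dual_pair[OF p] Ps.div_einstein_dual_pair[OF p]
    \<comment> \<open>only the two divergences with the connection of the other curvature are left to expand\<close>
    unfolding div_einstein[OF p] Ps.div_einstein[OF p] cov_scalar_def tf
    by simp
qed

end
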